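(* Let $(X,T)$ be a minimal PI system and $d\ge 2$. Then every $M$-subsystem of $(X^d,\tau_d)$ is minimal, where $\tau_d=T\times T^2\times\cdots\times T^d$.
   Context: A topological dynamical system (t.d.s.) is $(X,T)$ with $X$ compact metric (metric $\rho$) and $T$ a homeomorphism. A subsystem $(Z,\tau_d)$ is a closed $\tau_d$-invariant subset; it is an $M$-system if it is transitive (has a dense orbit) and its minimal points are dense. For a factor map $\pi:(X,T)\to(Y,T)$ let $R_\pi=\{(x_1,x_2):\pi(x_1)=\pi(x_2)\}$. A pair $(x,y)$ is proximal if $\liminf_{n}\rho(T^nx,T^ny)=0$; $\pi$ is proximal if every pair in $R_\pi$ is proximal; $\pi$ is equicontinuous if for every $\epsilon>0$ there is $\delta>0$ such that $(x,y)\in R_\pi$, $\rho(x,y)<\delta$ imply $\rho(T^nx,T^ny)<\epsilon$ for all $n\in\mathbb Z$. A minimal system $X$ is strictly PI if there are an ordinal $\eta$ and systems $\{W_\iota\}_{\iota\le\eta}$ with $W_0$ trivial, $W_\eta=X$, for each $\iota<\eta$ a factor map $W_{\iota+1}\to W_\iota$ which is proximal or equicontinuous, and for limit $\nu\le\eta$, $W_\nu$ the inverse limit of $\{W_\iota\}_{\iota<\nu}$. A minimal system $X$ is PI if there is a strictly PI system $\tilde X$ and a proximal extension $\tilde X\to X$. *)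

theory Defs
  imports "HOL-Analysis.Analysis"
begin

definition zpow :: "'a set \<Rightarrow> ('a \<Rightarrow> 'a) \<Rightarrow> int \<Rightarrow> 'a \<Rightarrow> 'a" where
  "zpow X T n = (if n \<ge> 0 then T ^^ nat n else (inv_into X T) ^^ nat (- n))"

definition orbit :: "'a set \<Rightarrow> ('a \<Rightarrow> 'a) \<Rightarrow> 'a \<Rightarrow> 'a set" where
  "orbit X T x = range (\<lambda>n. zpow X T n x)"

definition tds :: "'a::metric_space set \<Rightarrow> ('a \<Rightarrow> 'a) \<Rightarrow> bool" where
  "tds X T \<longleftrightarrow> compact X \<and> (\<exists>T'. homeomorphism X X T T')"

definition subsystem :: "'a::topological_space set \<Rightarrow> 'a set \<Rightarrow> ('a \<Rightarrow> 'a) \<Rightarrow> bool" where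
  "subsystem Z X T \<longleftrightarrow> Z \<subseteq> X \<and> closed Z \<and> T ` Z = Z"

definition minimal_sys :: "'a::topological_space set \<Rightarrow> ('a \<Rightarrow> 'a) \<Rightarrow> bool" where
  "minimal_sys X T \<longleftrightarrow> X \<noteq> {} \<and>
     (\<forall>A. A \<subseteq> X \<and> A \<noteq> {} \<and> closed A \<and> T ` A = A \<longrightarrow> A = X)"

definition minimal_point :: "'a::topological_space set \<Rightarrow> ('a \<Rightarrow> 'a) \<Rightarrow> 'a \<Rightarrow> bool" where
  "minimal_point Z T x \<longleftrightarrow> x \<in> Z \<and> minimal_sys (closure (orbit Z T x)) T"

definition transitive_sys :: "'a::topological_space set \<Rightarrow> ('a \<Rightarrow> 'a) \<Rightarrow> bool" where
  "transitive_sys Z T \<longleftrightarrow> (\<exists>x\<in>Z. closure (orbit Z T x) = Z)"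

definition M_system :: "'a::topological_space set \<Rightarrow> ('a \<Rightarrow> 'a) \<Rightarrow> bool" where
  "M_system Z T \<longleftrightarrow> transitive_sys Z T \<and> Z \<subseteq> closure {x. minimal_point Z T x}"

definition factor_map :: "'a::topological_space set \<Rightarrow> ('a \<Rightarrow> 'a) \<Rightarrow>
    'b::topological_space set \<Rightarrow> ('b \<Rightarrow> 'b) \<Rightarrow> ('a \<Rightarrow> 'b) \<Rightarrow> bool" where
  "factor_map X T Y S p \<longleftrightarrow> continuous_on X p \<and> p ` X = Y \<and> (\<forall>x\<in>X. p (T x) = S (p x))"

definition proximal_pair :: "('a::metric_space \<Rightarrow> 'a) \<Rightarrow> 'a \<Rightarrow> 'a \<Rightarrow> bool" where
  "proximal_pair T x y \<longleftrightarrow> (\<forall>e>0. \<forall>N. \<exists>n\<ge>N. dist ((T ^^ n) x) ((T ^^ n) y) < e)"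

definition proximal_ext :: "'a::metric_space set \<Rightarrow> ('a \<Rightarrow> 'a) \<Rightarrow> ('a \<Rightarrow> 'b) \<Rightarrow> bool" where
  "proximal_ext X T p \<longleftrightarrow> (\<forall>x\<in>X. \<forall>y\<in>X. p x = p y \<longrightarrow> proximal_pair T x y)"

definition equicont_ext :: "'a::metric_space set \<Rightarrow> ('a \<Rightarrow> 'a) \<Rightarrow> ('a \<Rightarrow> 'b) \<Rightarrow> bool" where
  "equicont_ext X T p \<longleftrightarrow> (\<forall>e>0. \<exists>\<delta>>0. \<forall>x\<in>X. \<forall>y\<in>X.
      p x = p y \<and> dist x y < \<delta> \<longrightarrow> (\<forall>n::int. dist (zpow X T n x) (zpow X T n y) < e))"

text \<open>Ordinals \<le> eta are represented by a well-order r (reflexive) with least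
  element z (= 0) and greatest element e (= eta).\<close>

definition is_succ :: "'i rel \<Rightarrow> 'i \<Rightarrow> 'i \<Rightarrow> bool" where
  "is_succ r i j \<longleftrightarrow> (i, j) \<in> r \<and> i \<noteq> j \<and> (\<forall>k. (i, k) \<in> r \<and> i \<noteq> k \<longrightarrow> (j, k) \<in> r)"

definition is_limit :: "'i rel \<Rightarrow> 'i \<Rightarrow> 'i \<Rightarrow> bool" where
  "is_limit r z v \<longleftrightarrow> v \<in> Field r \<and> v \<noteq> z \<and>
     (\<forall>i. (i, v) \<in> r \<and> i \<noteq> v \<longrightarrow> (\<exists>k. (i, k) \<in> r \<and> i \<noteq> k \<and> (k, v) \<in> r \<and> k \<noteq> v))"

definition inverse_limit_at :: "'i rel \<Rightarrow> ('i \<Rightarrow> 'w set) \<Rightarrow> ('i \<Rightarrow> 'i \<Rightarrow> 'w \<Rightarrow> 'w) \<Rightarrow> 'i \<Rightarrow> bool" where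
  "inverse_limit_at r W p v \<longleftrightarrow>
     (\<forall>x\<in>W v. \<forall>y\<in>W v. (\<forall>i. (i, v) \<in> r \<and> i \<noteq> v \<longrightarrow> p v i x = p v i y) \<longrightarrow> x = y) \<and>
     (\<forall>f. (\<forall>i. (i, v) \<in> r \<and> i \<noteq> v \<longrightarrow> f i \<in> W i) \<and>
          (\<forall>i j. (i, j) \<in> r \<and> (j, v) \<in> r \<and> j \<noteq> v \<longrightarrow> p j i (f j) = f i) \<longrightarrow>
          (\<exists>x\<in>W v. \<forall>i. (i, v) \<in> r \<and> i \<noteq> v \<longrightarrow> p v i x = f i))"

definition strictly_PI_tower ::
  "'i rel \<Rightarrow> 'i \<Rightarrow> 'i \<Rightarrow> ('i \<Rightarrow> 'w::metric_space set) \<Rightarrow> ('i \<Rightarrow> 'w \<Rightarrow> 'w) \<Rightarrow>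
   ('i \<Rightarrow> 'i \<Rightarrow> 'w \<Rightarrow> 'w) \<Rightarrow> bool" where
  "strictly_PI_tower r z e W S p \<longleftrightarrow>
     Well_order r \<and> z \<in> Field r \<and> e \<in> Field r \<and>
     (\<forall>i\<in>Field r. (z, i) \<in> r \<and> (i, e) \<in> r) \<and>
     (\<forall>i\<in>Field r. tds (W i) (S i)) \<and>
     (\<exists>w. W z = {w}) \<and>
     (\<forall>i j. (i, j) \<in> r \<longrightarrow> factor_map (W j) (S j) (W i) (S i) (p j i)) \<and>
     (\<forall>i\<in>Field r. \<forall>x\<in>W i. p i i x = x) \<and>
     (\<forall>i j k. (i, j) \<in> r \<and> (j, k) \<in> r \<longrightarrow> (\<forall>x\<in>W k. p j i (p k j x) = p k i x)) \<and>
     (\<forall>i j. is_succ r i j \<longrightarrow>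
        proximal_ext (W j) (S j) (p j i) \<or> equicont_ext (W j) (S j) (p j i)) \<and>
     (\<forall>v. is_limit r z v \<longrightarrow> inverse_limit_at r W p v)"

definition minimal_PI :: "'w::metric_space itself \<Rightarrow> 'i itself \<Rightarrow>
    'a::metric_space set \<Rightarrow> ('a \<Rightarrow> 'a) \<Rightarrow> bool" where
  "minimal_PI _ _ X T \<longleftrightarrow> tds X T \<and> minimal_sys X T \<and>
     (\<exists>(r::'i rel) z e (W::'i \<Rightarrow> 'w set) S p (\<phi>::'w \<Rightarrow> 'a).
        strictly_PI_tower r z e W S p \<and> minimal_sys (W e) (S e) \<and>
        factor_map (W e) (S e) X T \<phi> \<and> proximal_ext (W e) (S e) \<phi>)"

text \<open>X^d is represented as extensional functions on {0..<d}; coordinate i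
  carries T^(i+1).\<close>
definition power_sys :: "nat \<Rightarrow> 'a set \<Rightarrow> (nat \<Rightarrow> 'a) set" where
  "power_sys d X = PiE {..<d} (\<lambda>_. X)"

definition tau :: "nat \<Rightarrow> ('a \<Rightarrow> 'a) \<Rightarrow> (nat \<Rightarrow> 'a) \<Rightarrow> (nat \<Rightarrow> 'a)" where
  "tau d T x = (\<lambda>i. if i < d then (T ^^ Suc i) (x i) else undefined)"

end

theory Submission
  imports Defs
begin

text \<open>
  Everything is expressed through the lattice of closed invariant sets, which is compatible with
  images and preimages under equivariant maps. The given \<open>M\<close>-system \<open>Z\<close> lifts to an \<open>M\<close>-system in
  the power of the strictly PI system, and its images at the stages of the tower are shown to be
  minimal by transfinite induction.

  A proximal extension stays proximal for \<open>\<tau>\<^sub>d\<close>: a minimal subset of the fibre product projects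
  into the diagonal in every coordinate, because a pair which is proximal under \<open>T\<close> is also
  proximal along multiples of \<open>l\<close>. Hence two minimal sets with intersecting images coincide, so
  an \<open>M\<close>-system over a minimal one contains a single minimal set, which is then everything.
  For equicontinuous extensions a transitive point over a minimal system is itself minimal, by a
  packing argument in the fibres. Limit stages follow by compactness.
\<close>

section \<open>Closed invariant sets\<close>

text \<open>The coordinates of a tuple move with different powers of \<open>T\<close>. Two tuples
  that are proximal in each coordinate come close at times that depend on the coordinate, so
  closeness of the whole tuples is not immediate. A minimal set of pairs removes this obstacle: as
  soon as one of its pairs agrees in a coordinate, all of them do, and the coordinates can be
  treated one at a time. Closed invariant sets also absorb the change of powers, because a set
  invariant under \<open>T\<close> is invariant under every \<open>T ^^ Suc l\<close>. The two
  halves of an M-system serve different stages: density of the minimal points settles the proximal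
  steps, transitivity the equicontinuous ones. Hence both have to survive the projection down the
  tower, and also the lift, which is needed because the tower ends in a proximal extension of X and
  not in X itself.\<close>

definition compact_sys :: "'a::metric_space set \<Rightarrow> ('a \<Rightarrow> 'a) \<Rightarrow> bool" where
  "compact_sys X T \<longleftrightarrow> compact X \<and> continuous_on X T \<and> inj_on T X \<and> T ` X = X"

text \<open>Surjectivity is not demanded, so that diagonal embeddings and pairings
  \<open>\<lambda>x. (p x, q x)\<close> qualify.\<close>

definition sys_hom :: "'a::metric_space set \<Rightarrow> ('a \<Rightarrow> 'a) \<Rightarrow>
    'b::metric_space set \<Rightarrow> ('b \<Rightarrow> 'b) \<Rightarrow> ('a \<Rightarrow> 'b) \<Rightarrow> bool" where
  "sys_hom X T Y S p \<longleftrightarrow> compact_sys X T \<and> compact_sys Y S \<and>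
     continuous_on X p \<and> p ` X \<subseteq> Y \<and> (\<forall>x\<in>X. p (T x) = S (p x))"

definition minimal_sub :: "'a::metric_space set \<Rightarrow> 'a set \<Rightarrow> ('a \<Rightarrow> 'a) \<Rightarrow> bool" where
  "minimal_sub M X T \<longleftrightarrow> subsystem M X T \<and> minimal_sys M T"

lemma tds_imp_compact_sys: "tds X T \<Longrightarrow> compact_sys X T"
  unfolding tds_def compact_sys_def homeomorphism_def by (metis inj_onI)

lemma sys_homI:
  assumes "compact_sys X T" "compact_sys Y S" "continuous_on X p"
    and "\<And>x. x \<in> X \<Longrightarrow> p x \<in> Y" "\<And>x. x \<in> X \<Longrightarrow> p (T x) = S (p x)"
  shows "sys_hom X T Y S p"
  using assms unfolding sys_hom_def by blast

lemma sys_homD: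
  assumes "sys_hom X T Y S p"
  shows "compact_sys X T" "compact_sys Y S" "continuous_on X p"
    and "x \<in> X \<Longrightarrow> p x \<in> Y" "x \<in> X \<Longrightarrow> p (T x) = S (p x)"
  using assms unfolding sys_hom_def by auto

lemma factor_map_imp_sys_hom:
  assumes "tds X T" "tds Y S" "factor_map X T Y S p"
  shows "sys_hom X T Y S p"
  using assms by (auto simp: factor_map_def intro!: sys_homI tds_imp_compact_sys)

lemma subsystemD:
  assumes "subsystem A X T"
  shows "A \<subseteq> X" "closed A" "T ` A = A"
  using assms unfolding subsystem_def by auto

lemma subsystem_compact:
  assumes "compact_sys X T" "subsystem A X T"
  shows "compact A"
  by (metis assms closed_Int_compact compact_sys_def inf.orderE subsystemD(1,2))

lemma subsystem_self: "compact_sys X T \<Longrightarrow> subsystem X X T"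
  unfolding compact_sys_def subsystem_def by (simp add: compact_imp_closed)

text \<open>Injectivity makes the preimage \<open>x\<close> of \<open>y\<close> the same for all
  members, which gives equality and not just an inclusion for the image. The factor \<open>X\<close>
  covers the case of empty \<open>F\<close>.\<close>

lemma subsystem_Inter:
  assumes X: "compact_sys X T" and F: "\<And>A. A \<in> F \<Longrightarrow> subsystem A X T"
  shows "subsystem (X \<inter> \<Inter>F) X T"
proof -
  have inj: "inj_on T X" and TX: "T ` X = X" and cl: "closed X"
    using X by (auto simp: compact_sys_def compact_imp_closed)
  have "T ` (X \<inter> \<Inter>F) \<subseteq> X \<inter> \<Inter>F"
    using subsystemD(3)[OF F] TX by blast
  moreover have "y \<in> T ` (X \<inter> \<Inter>F)" if y: "y \<in> X \<inter> \<Inter>F" for y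
  proof -
    obtain x where x: "x \<in> X" "y = T x" using y TX by blast
    have "x \<in> A" if A: "A \<in> F" for A
    proof -
      have "y \<in> T ` A" "A \<subseteq> X" using F[OF A] y A by (auto dest: subsystemD)
      then show ?thesis using x inj by (auto dest: inj_onD)
    qed
    then show ?thesis using x by blast
  qed
  moreover have "closed (X \<inter> \<Inter>F)"
    using cl F by (intro closed_Int closed_Inter ballI) (auto dest: subsystemD)
  ultimately show ?thesis unfolding subsystem_def by blast
qed

lemma subsystem_Int:
  assumes "compact_sys X T" "subsystem A X T" "subsystem B X T"
  shows "subsystem (A \<inter> B) X T"
proof -
  have "X \<inter> \<Inter>{A, B} = A \<inter> B" using assms(2) by (auto dest: subsystemD)
  then show ?thesis using subsystem_Inter[of X T "{A, B}"] assms by auto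
qed

lemma subsystem_UN_finite:
  assumes "finite I" "\<And>i. i \<in> I \<Longrightarrow> subsystem (A i) X T"
  shows "subsystem (\<Union>i\<in>I. A i) X T"
  using assms unfolding subsystem_def by (auto simp: image_UN intro!: closed_UN)

lemma subsystem_closure:
  assumes X: "compact_sys X T" and U: "U \<subseteq> X" "T ` U = U"
  shows "subsystem (closure U) X T"
proof -
  have cX: "closed X" and cT: "continuous_on X T" and kX: "compact X"
    using X by (auto simp: compact_sys_def compact_imp_closed)
  have sub: "closure U \<subseteq> X" using U cX by (simp add: closure_minimal)
  then have cont: "continuous_on (closure U) T" and comp: "compact (closure U)"
    using cT kX compact_Int_closed[of X "closure U"]
    by (auto intro: continuous_on_subset simp: Int_absorb1)
  have "T ` closure U \<subseteq> closure U"
    using image_closure_subset[OF cont closed_closure] U closure_subset by metis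
  moreover have "closure U \<subseteq> T ` closure U"
  proof (rule closure_minimal)
    show "U \<subseteq> T ` closure U" using U(2) closure_subset by blast
    show "closed (T ` closure U)"
      by (simp add: comp cont compact_continuous_image compact_imp_closed)
  qed
  ultimately show ?thesis using sub by (auto simp: subsystem_def)
qed

lemma subsystem_closure_Union:
  assumes "compact_sys X T" "\<And>A. A \<in> F \<Longrightarrow> subsystem A X T"
  shows "subsystem (closure (\<Union>F)) X T"
proof (rule subsystem_closure[OF assms(1)])
  show "\<Union>F \<subseteq> X" using assms(2) by (auto dest: subsystemD)
  show "T ` \<Union>F = \<Union>F" using subsystemD(3)[OF assms(2)] by (simp add: image_Union)
qed

lemma subsystem_image:
  assumes h: "sys_hom X T Y S p" and A: "subsystem A X T"
  shows "subsystem (p ` A) Y S"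
proof -
  have "compact A" using subsystem_compact[OF sys_homD(1)[OF h] A] .
  then have "closed (p ` A)"
    by (meson A continuous_on_subset compact_continuous_image compact_imp_closed h
        subsystemD(1) sys_homD(3))
  moreover have "S ` p ` A = p ` T ` A"
    unfolding image_image using sys_homD(5)[OF h] subsystemD(1)[OF A]
    by (intro image_cong) auto
  ultimately show ?thesis
    using subsystemD[OF A] sys_homD(4)[OF h] unfolding subsystem_def by auto
qed

text \<open>Forward invariance is immediate; that the preimage is also covered by its own image
  rests on injectivity of \<open>S\<close>, which identifies \<open>p x\<close> with the point
  \<open>b\<close> of \<open>B\<close>.\<close>

lemma subsystem_vimage:
  assumes h: "sys_hom X T Y S p" and B: "subsystem B Y S"
  shows "subsystem {x \<in> X. p x \<in> B} X T"
proof -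
  have X: "T ` X = X" "closed X" and inj: "inj_on S Y"
    using sys_homD(1,2)[OF h] by (auto simp: compact_sys_def compact_imp_closed)
  have "closed {x \<in> X. p x \<in> B}"
    using continuous_closed_preimage[OF sys_homD(3)[OF h] X(2) subsystemD(2)[OF B]]
    by (simp add: vimage_def Int_def)
  moreover have "T ` {x \<in> X. p x \<in> B} \<subseteq> {x \<in> X. p x \<in> B}"
    using X(1) sys_homD(5)[OF h] subsystemD(3)[OF B] by auto
  moreover have "y \<in> T ` {x \<in> X. p x \<in> B}" if y: "y \<in> X" "p y \<in> B" for y
  proof -
    obtain x where x: "x \<in> X" "y = T x" using y X(1) by blast
    obtain b where b: "b \<in> B" "p y = S b" using y(2) subsystemD(3)[OF B] by blast
    have "S b = S (p x)" using b x sys_homD(5)[OF h] by metis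
    then have "b = p x"
      using inj b(1) subsystemD(1)[OF B] sys_homD(4)[OF h x(1)] by (auto dest: inj_onD)
    then show ?thesis using x b by blast
  qed
  ultimately show ?thesis unfolding subsystem_def by blast
qed

section \<open>Minimal sets\<close>

text \<open>A finite subfamily of a chain has a least member, so the finite intersection property is
  automatic. Needed for Zorn's lemma below and for the limit stages of the tower.\<close>

lemma compact_chain_Inter_nonempty:
  fixes F :: "'a::t2_space set set"
  assumes ne: "F \<noteq> {}" and cpt: "\<And>A. A \<in> F \<Longrightarrow> compact A" and e: "{} \<notin> F"
    and chain: "\<And>A B. A \<in> F \<Longrightarrow> B \<in> F \<Longrightarrow> A \<subseteq> B \<or> B \<subseteq> A"
  shows "\<Inter>F \<noteq> {}"
proof -
  obtain K where K: "K \<in> F" using ne by blast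
  have min: "\<exists>B\<in>insert K G. B \<subseteq> \<Inter>(insert K G)" if "finite G" "G \<subseteq> F" for G
    using that
  proof (induction G)
    case (insert A G)
    then obtain B where B: "B \<in> insert K G" "B \<subseteq> \<Inter>(insert K G)" by auto
    then have "A \<subseteq> B \<or> B \<subseteq> A" using chain insert.prems K by blast
    then show ?case using B by auto
  qed auto
  have "K \<inter> \<Inter>F \<noteq> {}"
  proof (rule compact_imp_fip[OF cpt[OF K]])
    show "closed A" if "A \<in> F" for A using that cpt compact_imp_closed by blast
    show "K \<inter> \<Inter>G \<noteq> {}" if G: "finite G" "G \<subseteq> F" for G
    proof -
      obtain B where "B \<in> insert K G" "B \<subseteq> \<Inter>(insert K G)" using min[OF G] by blast
      moreover from this have "B \<noteq> {}" using e K G by auto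
      ultimately show ?thesis by blast
    qed
  qed
  then show ?thesis by blast
qed

lemma minimal_subD:
  assumes "minimal_sub M X T"
  shows "subsystem M X T" "M \<noteq> {}" "M \<subseteq> X"
  using assms unfolding minimal_sub_def minimal_sys_def by (auto dest: subsystemD)

text \<open>The main tool: a condition that cuts out a closed invariant set holds on all of a
  minimal set once it holds at a single point.\<close>

lemma minimal_sub_subset:
  assumes X: "compact_sys X T" and M: "minimal_sub M X T" and A: "subsystem A X T"
    and ne: "M \<inter> A \<noteq> {}"
  shows "M \<subseteq> A"
proof -
  have "subsystem (M \<inter> A) X T" using subsystem_Int[OF X minimal_subD(1)[OF M] A] .
  then have "M \<inter> A = M"
    using M ne unfolding minimal_sub_def minimal_sys_def by (metis inf_le1 subsystemD(2,3))
  then show ?thesis by blast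
qed

lemma minimal_sub_eq:
  assumes "compact_sys X T" "minimal_sub M X T" "minimal_sub N X T" "M \<inter> N \<noteq> {}"
  shows "M = N"
proof
  show "M \<subseteq> N" using minimal_sub_subset[OF assms(1,2) minimal_subD(1)] assms(3,4) .
  show "N \<subseteq> M"
    using minimal_sub_subset[OF assms(1,3) minimal_subD(1)[OF assms(2)]] assms(4) by (simp add: Int_commute)
qed

lemma minimal_subI:
  assumes "subsystem M X T" "M \<noteq> {}"
    and "\<And>A. subsystem A X T \<Longrightarrow> A \<noteq> {} \<Longrightarrow> A \<subseteq> M \<Longrightarrow> M \<subseteq> A"
  shows "minimal_sub M X T"
proof -
  have "A = M" if "A \<subseteq> M" "A \<noteq> {}" "closed A" "T ` A = A" for A
  proof -
    have "subsystem A X T" using that subsystemD(1)[OF assms(1)] by (auto simp: subsystem_def)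
    then show ?thesis using assms(3) that by blast
  qed
  then show ?thesis using assms(1,2) unfolding minimal_sub_def minimal_sys_def by blast
qed

lemma minimal_sub_exists:
  assumes X: "compact_sys X T" and A: "subsystem A X T" "A \<noteq> {}"
  obtains M where "minimal_sub M X T" "M \<subseteq> A"
proof -
  let ?F = "{B. subsystem B X T \<and> B \<noteq> {} \<and> B \<subseteq> A}"
  \<comment> \<open>Complements turn the search for a minimal element of \<open>?F\<close> into one
    for a maximal element; unions of chains become intersections of nested compact sets.\<close>
  have "\<exists>M\<in>uminus ` ?F. \<forall>N\<in>uminus ` ?F. M \<subseteq> N \<longrightarrow> N = M"
  proof (rule subset_Zorn_nonempty)
    show "uminus ` ?F \<noteq> {}" using A by auto
  next
    fix C assume C: "C \<noteq> {}" "subset.chain (uminus ` ?F) C"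
    let ?G = "uminus ` C"
    have G: "B \<in> ?F" if "B \<in> ?G" for B
      using that C(2) unfolding subset.chain_def by auto
    have "\<Inter>?G \<noteq> {}"
    proof (rule compact_chain_Inter_nonempty)
      show "?G \<noteq> {}" using C(1) by simp
      show "compact B" if "B \<in> ?G" for B using G[OF that] subsystem_compact[OF X] by blast
      show "{} \<notin> ?G" using G by blast
      show "B \<subseteq> D \<or> D \<subseteq> B" if "B \<in> ?G" "D \<in> ?G" for B D
        using that C(2) unfolding subset_chain_def by auto
    qed
    moreover have sub: "\<Inter>?G \<subseteq> A" using C(1) G by blast
    moreover have "subsystem (\<Inter>?G) X T"
    proof -
      have "X \<inter> \<Inter>?G = \<Inter>?G" using sub subsystemD(1)[OF A(1)] by blast
      then show ?thesis using subsystem_Inter[OF X, of ?G] G by auto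
    qed
    ultimately have "\<Inter>?G \<in> ?F" by simp
    moreover have "\<Union>C = - \<Inter>?G" by auto
    ultimately show "\<Union>C \<in> uminus ` ?F" by blast
  qed
  then obtain M where M: "M \<in> ?F" "\<And>N. N \<in> ?F \<Longrightarrow> N \<subseteq> M \<Longrightarrow> N = M" by fastforce
  then have "minimal_sub M X T" by (intro minimal_subI) auto
  with M show ?thesis using that by blast
qed

lemma minimal_sub_image:
  assumes h: "sys_hom X T Y S p" and M: "minimal_sub M X T"
  shows "minimal_sub (p ` M) Y S"
proof (rule minimal_subI)
  show "subsystem (p ` M) Y S" using subsystem_image[OF h minimal_subD(1)[OF M]] .
  show "p ` M \<noteq> {}" using minimal_subD(2)[OF M] by blast
  fix A assume A: "subsystem A Y S" "A \<noteq> {}" "A \<subseteq> p ` M"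
  have "M \<subseteq> {x \<in> X. p x \<in> A}"
    using A minimal_subD(3)[OF M]
    by (intro minimal_sub_subset[OF sys_homD(1)[OF h] M subsystem_vimage[OF h]]) auto
  then show "p ` M \<subseteq> A" by blast
qed

text \<open>The second conjunct is transitivity: \<open>Z\<close> is the orbit closure of \<open>x\<close>.\<close>

definition M_sub :: "'a::metric_space set \<Rightarrow> 'a set \<Rightarrow> ('a \<Rightarrow> 'a) \<Rightarrow> bool" where
  "M_sub Z X T \<longleftrightarrow> subsystem Z X T \<and>
     (\<exists>x\<in>Z. \<forall>A. subsystem A X T \<and> x \<in> A \<longrightarrow> Z \<subseteq> A) \<and>
     Z \<subseteq> closure (\<Union>{M. minimal_sub M X T \<and> M \<subseteq> Z})"

section \<open>Integer powers, and the passage from orbits to closed invariant sets\<close>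

lemma zpow_mem:
  assumes "B \<subseteq> Z" "T ` B = B" "inj_on T Z" "x \<in> B"
  shows "zpow Z T n x \<in> B"
proof -
  have inv: "inv_into Z T y \<in> B" if "y \<in> B" for y
    using that assms(1-3) by (metis imageE inv_into_f_f subsetD)
  have "(T ^^ k) x \<in> B" for k using assms by (induction k) auto
  moreover have "(inv_into Z T ^^ k) x \<in> B" for k using assms(4) inv by (induction k) auto
  ultimately show ?thesis unfolding zpow_def by auto
qed

lemma zpow_nonneg: "zpow Z T (int k) = T ^^ k"
  by (simp add: zpow_def)

lemma zpow_nonpos: "zpow Z T (- int k) = inv_into Z T ^^ k"
  by (cases "k = 0") (simp_all add: zpow_def)

text \<open>The split is at -1, so that \<open>n\<close> and \<open>n + 1\<close> are on the same
  side of zero. Zero itself belongs to both sides: \<open>zpow_nonneg\<close> and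
  \<open>zpow_nonpos\<close> both hold for \<open>k = 0\<close>.\<close>

lemma int_succ_cases:
  obtains k where "n = int k" "n + 1 = int (Suc k)" | k where "n = - int (Suc k)" "n + 1 = - int k"
proof (cases "n \<ge> 0")
  case True
  then show ?thesis using that(1)[of "nat n"] by simp
next
  case False
  then show ?thesis using that(2)[of "nat (- n - 1)"] by simp
qed

lemma zpow_T:
  assumes "inj_on T Z" "x \<in> Z"
  shows "zpow Z T n (T x) = zpow Z T (n + 1) x"
proof (cases n rule: int_succ_cases)
  case (1 k)
  show ?thesis unfolding 1(2) unfolding 1(1) zpow_nonneg by (simp only: funpow_Suc_right comp_apply)
next
  case (2 k)
  show ?thesis unfolding 2(2) unfolding 2(1) zpow_nonpos
    by (simp only: funpow_Suc_right comp_apply inv_into_f_f[OF assms])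
qed

lemma T_zpow:
  assumes "T ` Z = Z" "x \<in> Z"
  shows "T (zpow Z T n x) = zpow Z T (n + 1) x"
proof (cases n rule: int_succ_cases)
  case (1 k)
  show ?thesis unfolding 1(2) unfolding 1(1) zpow_nonneg by simp
next
  case (2 k)
  have "(inv_into Z T ^^ k) x \<in> T ` Z"
    using assms by (induction k) (auto intro: inv_into_into)
  then show ?thesis unfolding 2(2) unfolding 2(1) zpow_nonpos by (simp add: f_inv_into_f)
qed

lemma T_orbit:
  assumes "T ` Z = Z" "x \<in> Z"
  shows "T ` orbit Z T x = orbit Z T x"
proof -
  have "T ` orbit Z T x = (\<lambda>n. zpow Z T n x) ` range (\<lambda>n. n + 1)"
    unfolding orbit_def image_image using T_zpow[OF assms] by simp
  also have "range (\<lambda>n::int. n + 1) = UNIV" by (metis add.commute diff_add_cancel surj_def)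
  finally show ?thesis unfolding orbit_def .
qed

lemma M_system_imp_M_sub:
  assumes X: "compact_sys X T" and Z: "subsystem Z X T" and M: "M_system Z T"
  shows "M_sub Z X T"
proof -
  have inj: "inj_on T Z" using X subsystemD(1)[OF Z] unfolding compact_sys_def
    using inj_on_subset by blast
  have orb: "orbit Z T x \<subseteq> A" if "x \<in> Z" "x \<in> A" "subsystem A X T" for x A
  proof -
    \<comment> \<open>The inverse occurring in \<open>orbit Z T x\<close> is taken inside
      \<open>Z\<close>, so the invariant set has to be cut down to \<open>Z\<close> before
      \<open>zpow_mem\<close> applies.\<close>
    have "T ` (A \<inter> Z) = A \<inter> Z" using subsystem_Int[OF X that(3) Z] by (rule subsystemD)
    then show ?thesis using zpow_mem[of "A \<inter> Z" Z T x] that inj unfolding orbit_def by blast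
  qed
  obtain x where x: "x \<in> Z" "closure (orbit Z T x) = Z"
    using M unfolding M_system_def transitive_sys_def by blast
  have "Z \<subseteq> A" if "subsystem A X T" "x \<in> A" for A
    using orb[OF x(1) that(2,1)] closure_minimal subsystemD(2)[OF that(1)] x(2) by metis
  moreover have "{x. minimal_point Z T x} \<subseteq> \<Union>{M. minimal_sub M X T \<and> M \<subseteq> Z}"
  proof
    fix y assume "y \<in> {x. minimal_point Z T x}"
    then have y: "y \<in> Z" "minimal_sys (closure (orbit Z T y)) T"
      unfolding minimal_point_def by auto
    have oZ: "orbit Z T y \<subseteq> Z" using orb[OF y(1) y(1) Z] .
    have "subsystem (closure (orbit Z T y)) X T"
      using oZ subsystemD(1)[OF Z] T_orbit[OF subsystemD(3)[OF Z] y(1)]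
      by (intro subsystem_closure[OF X]) auto
    moreover have "closure (orbit Z T y) \<subseteq> Z"
      using oZ subsystemD(2)[OF Z] by (simp add: closure_minimal)
    moreover have "y \<in> orbit Z T y"
      unfolding orbit_def by (rule image_eqI[of _ _ 0]) (auto simp: zpow_def)
    ultimately show "y \<in> \<Union>{M. minimal_sub M X T \<and> M \<subseteq> Z}"
      using y(2) closure_subset unfolding minimal_sub_def by blast
  qed
  then have "Z \<subseteq> closure (\<Union>{M. minimal_sub M X T \<and> M \<subseteq> Z})"
    using M closure_mono unfolding M_system_def by blast
  ultimately show ?thesis unfolding M_sub_def using Z x(1) by blast
qed

lemma M_sub_image:
  assumes h: "sys_hom X T Y S p" and Z: "M_sub Z X T"
  shows "M_sub (p ` Z) Y S"
proof -
  obtain x where x: "x \<in> Z" "\<And>A. subsystem A X T \<Longrightarrow> x \<in> A \<Longrightarrow> Z \<subseteq> A"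
    and sZ: "subsystem Z X T" and dense: "Z \<subseteq> closure (\<Union>{M. minimal_sub M X T \<and> M \<subseteq> Z})"
    using Z unfolding M_sub_def by blast
  have "p ` Z \<subseteq> A" if "subsystem A Y S" "p x \<in> A" for A
    using x(2)[OF subsystem_vimage[OF h that(1)]] x(1) that(2) subsystemD(1)[OF sZ] by blast
  moreover have "p ` Z \<subseteq> closure (\<Union>{M. minimal_sub M Y S \<and> M \<subseteq> p ` Z})" (is "_ \<subseteq> closure ?U")
  proof -
    have "continuous_on Z p" using sys_homD(3)[OF h] subsystemD(1)[OF sZ] continuous_on_subset by blast
    moreover have "closure (\<Union>{M. minimal_sub M X T \<and> M \<subseteq> Z}) = Z"
      using dense subsystemD(2)[OF sZ] by (intro equalityI closure_minimal) auto
    moreover have "p ` \<Union>{M. minimal_sub M X T \<and> M \<subseteq> Z} \<subseteq> ?U"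
      using minimal_sub_image[OF h] by blast
    ultimately show ?thesis
      using image_closure_subset[of "\<Union>{M. minimal_sub M X T \<and> M \<subseteq> Z}" p "closure ?U"]
        closure_subset[of ?U] by auto
  qed
  ultimately show ?thesis
    unfolding M_sub_def using subsystem_image[OF h sZ] x(1) by blast
qed

text \<open>All that is retained of a proximal extension: at most one minimal set lies above each
  minimal set of the base. For homomorphisms, images of minimal sets that meet are equal.\<close>

definition minimal_faithful :: "'a::metric_space set \<Rightarrow> ('a \<Rightarrow> 'a) \<Rightarrow> ('a \<Rightarrow> 'b) \<Rightarrow> bool" where
  "minimal_faithful X T p \<longleftrightarrow>
     (\<forall>M N. minimal_sub M X T \<and> minimal_sub N X T \<and> p ` M \<inter> p ` N \<noteq> {} \<longrightarrow> M = N)"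

lemma minimal_of_faithful:
  assumes h: "sys_hom X T Y S p" and f: "minimal_faithful X T p"
    and Z: "M_sub Z X T" and m: "minimal_sub (p ` Z) Y S"
  shows "minimal_sub Z X T"
proof -
  note X = sys_homD(1)[OF h]
  have sZ: "subsystem Z X T" and dense: "Z \<subseteq> closure (\<Union>{M. minimal_sub M X T \<and> M \<subseteq> Z})"
    using Z unfolding M_sub_def by auto
  have "Z \<noteq> {}" using minimal_subD(2)[OF m] by blast
  then obtain M where M: "minimal_sub M X T" "M \<subseteq> Z" using minimal_sub_exists[OF X sZ] by blast
  have "N = M" if N: "minimal_sub N X T" "N \<subseteq> Z" for N
  proof -
    have "p ` M = p ` Z" "p ` N = p ` Z"
      using minimal_sub_eq[OF sys_homD(2)[OF h] minimal_sub_image[OF h] m] M N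
        minimal_subD(2)[OF M(1)] minimal_subD(2)[OF N(1)] by blast+
    then show ?thesis using f M N \<open>Z \<noteq> {}\<close> unfolding minimal_faithful_def by blast
  qed
  then have "\<Union>{M. minimal_sub M X T \<and> M \<subseteq> Z} \<subseteq> M" by blast
  then have "Z \<subseteq> M"
    using dense closure_minimal[of _ M] subsystemD(2)[OF minimal_subD(1)[OF M(1)]] by blast
  then show ?thesis using M by (simp add: subset_antisym)
qed

lemma M_sub_lift:
  assumes h: "sys_hom X T Y S p" and onto: "p ` X = Y" and f: "minimal_faithful X T p"
    and Z: "M_sub Z Y S"
  obtains Z' where "M_sub Z' X T" "p ` Z' = Z"
proof -
  note X = sys_homD(1)[OF h]
  obtain y where y: "y \<in> Z" "\<And>A. subsystem A Y S \<Longrightarrow> y \<in> A \<Longrightarrow> Z \<subseteq> A"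
    and sZ: "subsystem Z Y S" and dense: "Z \<subseteq> closure (\<Union>{M. minimal_sub M Y S \<and> M \<subseteq> Z})"
    using Z unfolding M_sub_def by blast
  define F where "F = {M. minimal_sub M X T \<and> p ` M \<subseteq> Z}"
  define Z' where "Z' = closure (\<Union>F)"
  have sZ': "subsystem Z' X T"
    unfolding Z'_def F_def by (rule subsystem_closure_Union[OF X]) (auto dest: minimal_subD)
  have F_sub: "M \<subseteq> Z'" if "M \<in> F" for M
    unfolding Z'_def using that by (meson Union_upper closure_subset subset_trans)
  \<comment> \<open>Minimal sets of the base lift into any \<open>A\<close> whose image meets them:
    choose a minimal set inside the part of \<open>A\<close> lying over \<open>N\<close>.\<close>
  have above: "\<exists>M. minimal_sub M X T \<and> M \<subseteq> A \<and> p ` M = N"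
    if A: "subsystem A X T" and N: "minimal_sub N Y S" "N \<inter> p ` A \<noteq> {}" for A N
  proof -
    let ?B = "A \<inter> {x \<in> X. p x \<in> N}"
    have "subsystem ?B X T"
      using subsystem_Int[OF X A subsystem_vimage[OF h minimal_subD(1)[OF N(1)]]] .
    moreover have "?B \<noteq> {}" using N(2) subsystemD(1)[OF A] by blast
    ultimately obtain M where M: "minimal_sub M X T" "M \<subseteq> ?B"
      using minimal_sub_exists[OF X] by metis
    then have "p ` M = N"
      using minimal_sub_eq[OF sys_homD(2)[OF h] minimal_sub_image[OF h M(1)] N(1)]
        minimal_subD(2)[OF M(1)] by blast
    then show ?thesis using M by blast
  qed
  have image: "p ` Z' = Z"
  proof
    have "Z' \<subseteq> {x \<in> X. p x \<in> Z}"
      unfolding Z'_def using subsystemD(2)[OF subsystem_vimage[OF h sZ]]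
      by (intro closure_minimal) (auto simp: F_def dest: minimal_subD)
    then show "p ` Z' \<subseteq> Z" by blast
    have "\<Union>{M. minimal_sub M Y S \<and> M \<subseteq> Z} \<subseteq> p ` Z'"
    proof clarify
      fix b N assume b: "b \<in> N" and N: "minimal_sub N Y S" "N \<subseteq> Z"
      have "N \<inter> p ` X \<noteq> {}" using minimal_subD(2,3)[OF N(1)] onto by blast
      then obtain M where M: "minimal_sub M X T" "p ` M = N"
        using above[OF subsystem_self[OF X] N(1)] by blast
      then have "M \<in> F" using N(2) by (simp add: F_def)
      then have "M \<subseteq> Z'" using F_sub by blast
      then show "b \<in> p ` Z'" using M b by blast
    qed
    then show "Z \<subseteq> p ` Z'"
      using dense closure_minimal[of _ "p ` Z'"] subsystemD(2)[OF subsystem_image[OF h sZ']] by blast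
  qed
  obtain x where x: "x \<in> Z'" "p x = y" using y(1) image by blast
  have "Z' \<subseteq> A" if A: "subsystem A X T" "x \<in> A" for A
  proof -
    have ZA: "Z \<subseteq> p ` A" using y(2)[OF subsystem_image[OF h A(1)]] x A(2) by blast
    have "M \<subseteq> A" if M: "M \<in> F" for M
    proof -
      have m: "minimal_sub M X T" and pM: "p ` M \<subseteq> Z" "p ` M \<noteq> {}"
        using M minimal_subD(2) unfolding F_def by auto
      obtain N where N: "minimal_sub N X T" "N \<subseteq> A" "p ` N = p ` M"
        using above[OF A(1) minimal_sub_image[OF h m]] pM ZA by blast
      then have "N = M" using f m pM(2) unfolding minimal_faithful_def by blast
      then show ?thesis using N by blast
    qed
    then show ?thesis unfolding Z'_def using subsystemD(2)[OF A(1)] by (intro closure_minimal) auto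
  qed
  moreover have "Z' \<subseteq> closure (\<Union>{M. minimal_sub M X T \<and> M \<subseteq> Z'})"
  proof -
    have "\<Union>F \<subseteq> \<Union>{M. minimal_sub M X T \<and> M \<subseteq> Z'}"
    proof (rule Union_mono, rule subsetI)
      show "M \<in> {M. minimal_sub M X T \<and> M \<subseteq> Z'}" if "M \<in> F" for M
        using that F_sub[OF that] by (simp add: F_def)
    qed
    from closure_mono[OF this] show ?thesis by (simp only: Z'_def[symmetric])
  qed
  ultimately have "M_sub Z' X T" unfolding M_sub_def using sZ' x(1) by blast
  then show ?thesis using image that by blast
qed

section \<open>Power systems\<close>

text \<open>One notion for the dynamics (\<open>tau\<close>, and later the same \<open>T\<close> in
  every coordinate) and for the maps induced on powers. The default value keeps the result
  extensional, as \<open>power_sys\<close> requires.\<close>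

definition cmap :: "nat \<Rightarrow> (nat \<Rightarrow> 'a \<Rightarrow> 'b) \<Rightarrow> (nat \<Rightarrow> 'a) \<Rightarrow> nat \<Rightarrow> 'b" where
  "cmap d F x = (\<lambda>i. if i < d then F i (x i) else undefined)"

lemma tau_eq_cmap: "tau d T = cmap d (\<lambda>i. T ^^ Suc i)"
  by (simp add: tau_def cmap_def fun_eq_iff)

lemma cmap_apply: "i < d \<Longrightarrow> cmap d F x i = F i (x i)"
  by (simp add: cmap_def)

lemma power_sysD: "x \<in> power_sys d X \<Longrightarrow> i < d \<Longrightarrow> x i \<in> X"
  by (auto simp: power_sys_def)

lemma power_sys_ext:
  assumes "x \<in> power_sys d X" "y \<in> power_sys d Y" "\<And>i. i < d \<Longrightarrow> x i = y i"
  shows "x = y"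
proof
  fix i
  show "x i = y i" using assms by (cases "i < d") (auto simp: power_sys_def PiE_def extensional_def)
qed

lemma power_sysI:
  assumes "\<And>i. i < d \<Longrightarrow> x i \<in> X" "\<And>i. i \<ge> d \<Longrightarrow> x i = undefined"
  shows "x \<in> power_sys d X"
  using assms by (fastforce simp: power_sys_def PiE_def extensional_def)

lemma cmap_mem:
  assumes "x \<in> power_sys d X" "\<And>i u. i < d \<Longrightarrow> u \<in> X \<Longrightarrow> F i u \<in> Y"
  shows "cmap d F x \<in> power_sys d Y"
  using assms power_sysD[of x d X] by (intro power_sysI) (auto simp: cmap_def)

text \<open>The topology on functions is the product over all indices. Giving the indices from
  \<open>d\<close> on the compact factor \<open>{undefined}\<close> makes Tychonoff's theorem
  applicable.\<close>

lemma compact_power_sys: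
  assumes "compact X"
  shows "compact (power_sys d X)"
proof -
  have "power_sys d X = (\<Pi>\<^sub>E i\<in>UNIV. if i < d then X else {undefined})"
    by (auto simp: power_sys_def PiE_def Pi_def extensional_def split: if_splits)
  moreover have "compactin (product_topology (\<lambda>_. euclidean) UNIV)
      (\<Pi>\<^sub>E i\<in>UNIV. if i < d then X else {undefined})"
    using assms by (subst compactin_PiE) auto
  ultimately show ?thesis by (simp add: euclidean_product_topology)
qed

lemma continuous_on_cmap:
  assumes "\<And>i. i < d \<Longrightarrow> continuous_on X (F i)"
  shows "continuous_on (power_sys d X) (cmap d F)"
proof (rule continuous_on_coordinatewise_then_product)
  fix i
  show "continuous_on (power_sys d X) (\<lambda>x. cmap d F x i)"
  proof (cases "i < d")
    case True
    then have "continuous_on (power_sys d X) (\<lambda>x. F i (x i))"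
      by (intro continuous_on_compose2[OF assms[OF True]]
          continuous_on_subset[OF continuous_on_product_coordinates]) (auto dest: power_sysD)
    then show ?thesis using True by (simp add: cmap_def)
  qed (simp add: cmap_def)
qed

lemma compact_sys_cmap:
  assumes "\<And>i. i < d \<Longrightarrow> compact_sys X (F i)" and "compact X"
  shows "compact_sys (power_sys d X) (cmap d F)"
proof -
  have F: "continuous_on X (F i)" "inj_on (F i) X" "F i ` X = X" if "i < d" for i
    using assms(1)[OF that] by (auto simp: compact_sys_def)
  have "inj_on (cmap d F) (power_sys d X)"
  proof (rule inj_onI)
    fix x y assume x: "x \<in> power_sys d X" and y: "y \<in> power_sys d X" and eq: "cmap d F x = cmap d F y"
    show "x = y"
    proof (rule power_sys_ext[OF x y])
      fix i assume i: "i < d"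
      then have "F i (x i) = F i (y i)" using fun_cong[OF eq, of i] by (simp add: cmap_def)
      then show "x i = y i" using F(2)[OF i] power_sysD[OF x i] power_sysD[OF y i] by (auto dest: inj_onD)
    qed
  qed
  moreover have "cmap d F ` power_sys d X = power_sys d X"
  proof
    show "cmap d F ` power_sys d X \<subseteq> power_sys d X" using F(3) by (auto intro!: cmap_mem)
    show "power_sys d X \<subseteq> cmap d F ` power_sys d X"
    proof
      fix y assume y: "y \<in> power_sys d X"
      define x where "x = cmap d (\<lambda>i. inv_into X (F i)) y"
      have x: "x \<in> power_sys d X"
        unfolding x_def using F(3) by (intro cmap_mem[OF y]) (metis inv_into_into)
      have "cmap d F x = y"
      proof (rule power_sys_ext[OF _ y])
        show "cmap d F x \<in> power_sys d X" using F(3) by (intro cmap_mem[OF x]) blast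
        show "cmap d F x i = y i" if "i < d" for i
          using that F(3)[OF that] power_sysD[OF y that] by (simp add: x_def cmap_def f_inv_into_f)
      qed
      then show "y \<in> cmap d F ` power_sys d X" using x by blast
    qed
  qed
  ultimately show ?thesis
    using continuous_on_cmap[OF F(1)] compact_power_sys[OF assms(2)] by (simp add: compact_sys_def)
qed

lemma compact_sys_funpow:
  assumes "compact_sys X T"
  shows "compact_sys X (T ^^ n)"
proof (induction n)
  case 0
  then show ?case using assms by (simp add: compact_sys_def)
next
  case (Suc n)
  have "continuous_on X (T \<circ> T ^^ n)" "inj_on (T \<circ> T ^^ n) X"
    using assms Suc unfolding compact_sys_def by (metis continuous_on_compose, metis comp_inj_on)
  moreover have "(T \<circ> T ^^ n) ` X = X"
    using assms Suc unfolding compact_sys_def by (metis image_comp)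
  ultimately show ?case using assms by (simp add: compact_sys_def comp_def)
qed

lemma compact_sys_tau: "compact_sys X T \<Longrightarrow> compact_sys (power_sys d X) (tau d T)"
  unfolding tau_eq_cmap by (rule compact_sys_cmap) (auto simp: compact_sys_funpow compact_sys_def[of X T] simp del: funpow.simps)

lemma sys_hom_funpow:
  assumes "sys_hom X T Y S p"
  shows "sys_hom X (T ^^ n) Y (S ^^ n) p"
proof (rule sys_homI)
  show "compact_sys X (T ^^ n)" "compact_sys Y (S ^^ n)"
    using assms by (auto intro: compact_sys_funpow sys_homD)
  show "continuous_on X p" "\<And>x. x \<in> X \<Longrightarrow> p x \<in> Y" using sys_homD[OF assms] by auto
  fix x assume x: "x \<in> X"
  have "T ` X = X" using sys_homD(1)[OF assms] by (simp add: compact_sys_def)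
  then have mem: "(T ^^ n) x \<in> X" for n using x by (induction n) auto
  show "p ((T ^^ n) x) = (S ^^ n) (p x)"
    by (induction n) (auto simp: sys_homD(5)[OF assms mem])
qed

lemma sys_hom_cmap:
  assumes "\<And>i. i < d \<Longrightarrow> sys_hom X (F i) Y (G i) p" "compact X" "compact Y"
  shows "sys_hom (power_sys d X) (cmap d F) (power_sys d Y) (cmap d G) (cmap d (\<lambda>_. p))"
proof (rule sys_homI)
  show "compact_sys (power_sys d X) (cmap d F)" "compact_sys (power_sys d Y) (cmap d G)"
    using assms by (auto intro!: compact_sys_cmap dest: sys_homD(1,2))
  show "continuous_on (power_sys d X) (cmap d (\<lambda>_. p))"
    using assms by (intro continuous_on_cmap) (auto dest: sys_homD)
  fix x assume x: "x \<in> power_sys d X"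
  show "cmap d (\<lambda>_. p) x \<in> power_sys d Y"
    using assms(1) by (intro cmap_mem[OF x]) (auto dest: sys_homD)
  show "cmap d (\<lambda>_. p) (cmap d F x) = cmap d G (cmap d (\<lambda>_. p) x)"
    using sys_homD(5)[OF assms(1)] power_sysD[OF x] by (simp add: cmap_def fun_eq_iff)
qed

lemma sys_hom_tau:
  assumes "sys_hom X T Y S p"
  shows "sys_hom (power_sys d X) (tau d T) (power_sys d Y) (tau d S) (cmap d (\<lambda>_. p))"
  unfolding tau_eq_cmap
  using assms sys_homD(1,2)[OF assms]
  by (intro sys_hom_cmap sys_hom_funpow) (auto simp: compact_sys_def)

lemma cmap_image_power_sys:
  assumes "p ` X = Y"
  shows "cmap d (\<lambda>_. p) ` power_sys d X = power_sys d Y"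
proof
  show "cmap d (\<lambda>_. p) ` power_sys d X \<subseteq> power_sys d Y" using assms by (auto intro!: cmap_mem)
  show "power_sys d Y \<subseteq> cmap d (\<lambda>_. p) ` power_sys d X"
  proof
    fix y assume y: "y \<in> power_sys d Y"
    define x where "x = cmap d (\<lambda>_. inv_into X p) y"
    have x: "x \<in> power_sys d X"
      unfolding x_def using assms by (intro cmap_mem[OF y]) (metis inv_into_into)
    have "cmap d (\<lambda>_. p) x = y"
    proof (rule power_sys_ext[OF _ y])
      show "cmap d (\<lambda>_. p) x \<in> power_sys d Y" using assms by (intro cmap_mem[OF x]) blast
      show "cmap d (\<lambda>_. p) x i = y i" if "i < d" for i
        using that assms power_sysD[OF y that] by (simp add: x_def cmap_def f_inv_into_f)
    qed
    then show "y \<in> cmap d (\<lambda>_. p) ` power_sys d X" using x by blast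
  qed
qed

lemma sys_hom_coordinate:
  assumes "i < d" "\<And>j. j < d \<Longrightarrow> compact_sys X (F j)" "compact X"
  shows "sys_hom (power_sys d X) (cmap d F) X (F i) (\<lambda>x. x i)"
proof (rule sys_homI)
  show "continuous_on (power_sys d X) (\<lambda>x. x i)"
    by (rule continuous_on_subset[OF continuous_on_product_coordinates]) auto
qed (use assms in \<open>auto intro: compact_sys_cmap power_sysD simp: cmap_apply\<close>)

section \<open>Products\<close>

lemma compact_sys_map_prod:
  assumes "compact_sys X T" "compact_sys Y S"
  shows "compact_sys (X \<times> Y) (map_prod T S)"
proof -
  have c: "continuous_on X T" "continuous_on Y S" using assms by (auto simp: compact_sys_def)
  have "continuous_on (X \<times> Y) (\<lambda>z. (T (fst z), S (snd z)))"
    by (intro continuous_on_Pair continuous_on_compose2[OF c(1) continuous_on_fst[OF continuous_on_id]]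
        continuous_on_compose2[OF c(2) continuous_on_snd[OF continuous_on_id]]) auto
  then show ?thesis
    using assms by (auto simp: compact_sys_def map_prod_def case_prod_beta' compact_Times
        inj_on_def image_def) blast+
qed

lemma sys_hom_Pair:
  assumes "sys_hom X T Y S p" "sys_hom X T Y' S' q"
  shows "sys_hom X T (Y \<times> Y') (map_prod S S') (\<lambda>x. (p x, q x))"
  using sys_homD[OF assms(1)] sys_homD[OF assms(2)]
  by (intro sys_homI compact_sys_map_prod continuous_on_Pair) auto

lemma sys_hom_fst: "compact_sys X T \<Longrightarrow> compact_sys Y S \<Longrightarrow> sys_hom (X \<times> Y) (map_prod T S) X T fst"
  by (intro sys_homI compact_sys_map_prod continuous_on_fst continuous_on_id) auto

lemma sys_hom_snd: "compact_sys X T \<Longrightarrow> compact_sys Y S \<Longrightarrow> sys_hom (X \<times> Y) (map_prod T S) Y S snd"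
  by (intro sys_homI compact_sys_map_prod continuous_on_snd continuous_on_id) auto

lemma sys_hom_comp:
  assumes "sys_hom X T Y S p" "sys_hom Y S V R q"
  shows "sys_hom X T V R (\<lambda>x. q (p x))"
  using sys_homD[OF assms(1)] sys_homD[OF assms(2)]
  by (intro sys_homI continuous_on_compose2[where g = q and f = p]) auto

text \<open>The diagonal is a closed invariant set, being the image of \<open>Y\<close>, and the
  equalizer is its preimage under the pairing of \<open>p\<close> and \<open>q\<close>. Applied to
  the two projections followed by a factor map, this yields the fibre product.\<close>

lemma subsystem_equalizer:
  assumes p: "sys_hom X T Y S p" and q: "sys_hom X T Y S q"
  shows "subsystem {x \<in> X. p x = q x} X T"
proof -
  have Y: "compact_sys Y S" using p by (rule sys_homD)
  have "subsystem ((\<lambda>y. (y, y)) ` Y) (Y \<times> Y) (map_prod S S)"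
  proof (rule subsystem_image)
    have "sys_hom Y S Y S (\<lambda>y. y)" using Y by (intro sys_homI continuous_on_id) auto
    then show "sys_hom Y S (Y \<times> Y) (map_prod S S) (\<lambda>y. (y, y))" using sys_hom_Pair by blast
  qed (rule subsystem_self[OF Y])
  from subsystem_vimage[OF sys_hom_Pair[OF p q] this]
  have "subsystem {x \<in> X. (p x, q x) \<in> (\<lambda>y. (y, y)) ` Y} X T" .
  moreover have "{x \<in> X. (p x, q x) \<in> (\<lambda>y. (y, y)) ` Y} = {x \<in> X. p x = q x}"
    using sys_homD(4)[OF p] by force
  ultimately show ?thesis by simp
qed

section \<open>Proximal extensions\<close>

lemma uniformly_continuous_funpow:
  assumes X: "compact_sys X T" and c: "c > 0"
  shows "\<exists>\<eta>>0. \<forall>u\<in>X. \<forall>v\<in>X. dist u v < \<eta> \<longrightarrow> (\<forall>j\<le>k. dist ((T ^^ j) u) ((T ^^ j) v) < c)"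
proof (induction k)
  case 0
  show ?case using c by (intro exI[of _ c]) auto
next
  case (Suc k)
  then obtain \<eta> where \<eta>: "\<eta> > 0"
    "\<And>u v j. u \<in> X \<Longrightarrow> v \<in> X \<Longrightarrow> dist u v < \<eta> \<Longrightarrow> j \<le> k \<Longrightarrow> dist ((T ^^ j) u) ((T ^^ j) v) < c"
    by blast
  have "uniformly_continuous_on X (T ^^ Suc k)"
    using compact_sys_funpow[OF X, of "Suc k"] unfolding compact_sys_def
    by (blast intro: compact_uniformly_continuous)
  then obtain \<theta> where \<theta>: "\<theta> > 0"
    "\<And>u v. u \<in> X \<Longrightarrow> v \<in> X \<Longrightarrow> dist u v < \<theta> \<Longrightarrow> dist ((T ^^ Suc k) u) ((T ^^ Suc k) v) < c"
    using c unfolding uniformly_continuous_on_def by (metis dist_commute)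
  show ?case
  proof (intro exI[of _ "min \<eta> \<theta>"] conjI ballI impI allI)
    fix u v j assume "u \<in> X" "v \<in> X" "dist u v < min \<eta> \<theta>" "j \<le> Suc k"
    then show "dist ((T ^^ j) u) ((T ^^ j) v) < c"
      using \<eta>(2) \<theta>(2) by (cases "j = Suc k") (auto simp del: funpow.simps)
  qed (use \<eta> \<theta> in auto)
qed

lemma compact_sys_funpow_mem: "compact_sys X T \<Longrightarrow> x \<in> X \<Longrightarrow> (T ^^ n) x \<in> X"
  using compact_sys_funpow[of X T n] unfolding compact_sys_def by blast

text \<open>Round a time of closeness up to a multiple of \<open>Suc l\<close>. The delay is bounded
  by \<open>Suc l\<close>, so uniform continuity of finitely many iterates keeps the points
  close.\<close>

lemma proximal_pair_along_multiples:
  assumes X: "compact_sys X T" and uv: "u \<in> X" "v \<in> X" "proximal_pair T u v" and c: "c > 0"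
  shows "\<exists>m. dist (((T ^^ Suc l) ^^ m) u) (((T ^^ Suc l) ^^ m) v) < c"
proof -
  obtain \<eta> where \<eta>: "\<eta> > 0"
    "\<And>u v j. u \<in> X \<Longrightarrow> v \<in> X \<Longrightarrow> dist u v < \<eta> \<Longrightarrow> j \<le> Suc l \<Longrightarrow> dist ((T ^^ j) u) ((T ^^ j) v) < c"
    using uniformly_continuous_funpow[OF X c, of "Suc l"] by blast
  obtain n where n: "dist ((T ^^ n) u) ((T ^^ n) v) < \<eta>"
    using uv(3) \<eta>(1) unfolding proximal_pair_def by blast
  \<comment> \<open>If \<open>n\<close> is already a multiple, a full period is added:
    \<open>j = Suc l\<close> then, which is why \<open>\<eta>\<close> was chosen for all delays up
    to and including \<open>Suc l\<close>.\<close>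
  define m j where "m = n div Suc l + 1" and "j = Suc l - n mod Suc l"
  have "j + n = Suc l * m"
  proof -
    have "n mod Suc l \<le> Suc l" by (simp add: less_imp_le)
    moreover have "n = Suc l * (n div Suc l) + n mod Suc l" by (simp only: mult_div_mod_eq)
    ultimately show ?thesis unfolding m_def j_def distrib_left mult_1_right by linarith
  qed
  then have eq: "((T ^^ Suc l) ^^ m) w = (T ^^ j) ((T ^^ n) w)" for w
    by (metis comp_apply funpow_add funpow_mult mult.commute)
  have "dist ((T ^^ j) ((T ^^ n) u)) ((T ^^ j) ((T ^^ n) v)) < c"
    using n by (intro \<eta>(2) compact_sys_funpow_mem[OF X] uv) (auto simp: j_def)
  then show ?thesis using eq by metis
qed

lemma sys_hom_tau_coordinate:
  assumes "compact_sys X T" "l < d"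
  shows "sys_hom (power_sys d X) (tau d T) X (T ^^ Suc l) (\<lambda>x. x l)"
  unfolding tau_eq_cmap using assms compact_sys_funpow[OF assms(1)]
  by (intro sys_hom_coordinate) (auto simp: compact_sys_def simp del: funpow.simps)

lemma subsystem_Times:
  assumes X: "compact_sys X T" and Y: "compact_sys Y S" and A: "subsystem A X T" and B: "subsystem B Y S"
  shows "subsystem (A \<times> B) (X \<times> Y) (map_prod T S)"
proof -
  have "subsystem ({z \<in> X \<times> Y. fst z \<in> A} \<inter> {z \<in> X \<times> Y. snd z \<in> B}) (X \<times> Y) (map_prod T S)"
    by (intro subsystem_Int compact_sys_map_prod X Y subsystem_vimage[OF sys_hom_fst[OF X Y] A]
        subsystem_vimage[OF sys_hom_snd[OF X Y] B])
  moreover have "{z \<in> X \<times> Y. fst z \<in> A} \<inter> {z \<in> X \<times> Y. snd z \<in> B} = A \<times> B"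
    using subsystemD(1)[OF A] subsystemD(1)[OF B] by auto
  ultimately show ?thesis by simp
qed

lemma proximal_ext_imp_minimal_faithful:
  assumes h: "sys_hom X T Y S p" and prox: "proximal_ext X T p"
  shows "minimal_faithful (power_sys d X) (tau d T) (cmap d (\<lambda>_. p))"
  unfolding minimal_faithful_def
proof (intro allI impI, elim conjE)
  let ?P = "power_sys d X" and ?t = "tau d T" and ?p = "cmap d (\<lambda>_. p)"
  fix M N
  assume M: "minimal_sub M ?P ?t" and N: "minimal_sub N ?P ?t" and MN: "?p ` M \<inter> ?p ` N \<noteq> {}"
  have X: "compact_sys X T" using h by (rule sys_homD)
  have P: "compact_sys ?P ?t" using X by (rule compact_sys_tau)
  have PP: "compact_sys (?P \<times> ?P) (map_prod ?t ?t)" by (rule compact_sys_map_prod[OF P P])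
  note fst = sys_hom_fst[OF P P] and snd = sys_hom_snd[OF P P]
  let ?R = "{z \<in> ?P \<times> ?P. ?p (fst z) = ?p (snd z)}"
  have "subsystem (M \<times> N \<inter> ?R) (?P \<times> ?P) (map_prod ?t ?t)"
    using minimal_subD(1)[OF M] minimal_subD(1)[OF N]
    by (intro subsystem_Int PP subsystem_Times P
        subsystem_equalizer[OF sys_hom_comp[OF fst sys_hom_tau[OF h]] sys_hom_comp[OF snd sys_hom_tau[OF h]]])
  moreover have "M \<times> N \<inter> ?R \<noteq> {}"
  proof -
    obtain a b where "a \<in> M" "b \<in> N" "?p a = ?p b" using MN by blast
    then have "(a, b) \<in> M \<times> N \<inter> ?R" using minimal_subD(3)[OF M] minimal_subD(3)[OF N] by auto
    then show ?thesis by blast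
  qed
  ultimately obtain Q where Q: "minimal_sub Q (?P \<times> ?P) (map_prod ?t ?t)" "Q \<subseteq> M \<times> N \<inter> ?R"
    by (rule minimal_sub_exists[OF PP])
  have "Q \<subseteq> {z \<in> ?P \<times> ?P. fst z l = snd z l}" if l: "l < d" for l
  proof (rule minimal_sub_subset[OF PP Q(1)])
    note fl = sys_hom_comp[OF fst sys_hom_tau_coordinate[OF X l]]
      and sl = sys_hom_comp[OF snd sys_hom_tau_coordinate[OF X l]]
    show "subsystem {z \<in> ?P \<times> ?P. fst z l = snd z l} (?P \<times> ?P) (map_prod ?t ?t)"
      by (rule subsystem_equalizer[OF fl sl])
    have "compact Q" using subsystem_compact[OF PP minimal_subD(1)[OF Q(1)]] .
    moreover have "continuous_on Q (\<lambda>z. dist (fst z l) (snd z l))"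
      using continuous_on_subset[OF sys_homD(3)[OF fl] minimal_subD(3)[OF Q(1)]]
        continuous_on_subset[OF sys_homD(3)[OF sl] minimal_subD(3)[OF Q(1)]]
      by (rule continuous_on_dist)
    \<comment> \<open>Choose a pair of \<open>Q\<close> whose \<open>l\<close>-th coordinates are
      closest. Were their distance positive, proximality along multiples of \<open>Suc l\<close>
      would bring an iterate, still in \<open>Q\<close>, strictly below the minimum.\<close>
    ultimately have "\<exists>z\<in>Q. \<forall>w\<in>Q. dist (fst z l) (snd z l) \<le> dist (fst w l) (snd w l)"
      by (intro continuous_attains_inf minimal_subD(2)[OF Q(1)])
    then obtain z where z: "z \<in> Q"
      "\<And>w. w \<in> Q \<Longrightarrow> dist (fst z l) (snd z l) \<le> dist (fst w l) (snd w l)"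
      by blast
    have zP: "z \<in> ?P \<times> ?P" "?p (fst z) = ?p (snd z)" using z(1) Q(2) by auto
    then have zl: "fst z l \<in> X" "snd z l \<in> X" using l by (auto intro: power_sysD)
    have "p (fst z l) = p (snd z l)" using fun_cong[OF zP(2), of l] l by (simp add: cmap_def)
    then have pr: "proximal_pair T (fst z l) (snd z l)" using prox zl by (simp add: proximal_ext_def)
    have "fst z l = snd z l"
    proof (rule ccontr)
      assume "fst z l \<noteq> snd z l"
      then have "dist (fst z l) (snd z l) > 0" by simp
      from proximal_pair_along_multiples[OF X zl pr this, of l]
      obtain m where m: "dist (((T ^^ Suc l) ^^ m) (fst z l)) (((T ^^ Suc l) ^^ m) (snd z l))
          < dist (fst z l) (snd z l)" by blast
      let ?w = "(map_prod ?t ?t ^^ m) z"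
      have "(map_prod ?t ?t ^^ k) z \<in> Q" for k
        using z(1) subsystemD(3)[OF minimal_subD(1)[OF Q(1)]] by (induction k) auto
      then have "dist (fst z l) (snd z l) \<le> dist (fst ?w l) (snd ?w l)" by (rule z(2))
      moreover have "fst ?w l = ((T ^^ Suc l) ^^ m) (fst z l)" "snd ?w l = ((T ^^ Suc l) ^^ m) (snd z l)"
        using sys_homD(5)[OF sys_hom_funpow[OF fl, of m] zP(1)]
          sys_homD(5)[OF sys_hom_funpow[OF sl, of m] zP(1)] by auto
      ultimately show False using m by simp
    qed
    then show "Q \<inter> {z \<in> ?P \<times> ?P. fst z l = snd z l} \<noteq> {}" using z(1) zP(1) by blast
  qed
  moreover obtain a b where ab: "(a, b) \<in> Q" using minimal_subD(2)[OF Q(1)] by fastforce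
  ultimately have "a l = b l" if "l < d" for l using that by fastforce
  moreover have "a \<in> ?P" "b \<in> ?P" "a \<in> M" "b \<in> N" using ab Q(2) by auto
  ultimately have "a = b" by (blast intro: power_sys_ext)
  then have "M \<inter> N \<noteq> {}" using \<open>a \<in> M\<close> \<open>b \<in> N\<close> by blast
  then show "M = N" by (rule minimal_sub_eq[OF P M N])
qed

section \<open>Equicontinuous extensions\<close>

text \<open>Equicontinuity in terms of closed invariant sets: the pairs in a common fibre that are
  \<open>e\<close>-apart generate a closed invariant set which stays away from the diagonal.\<close>

definition fibre_separated :: "'a::metric_space set \<Rightarrow> ('a \<Rightarrow> 'a) \<Rightarrow> ('a \<Rightarrow> 'b) \<Rightarrow> bool" where
  "fibre_separated X T p \<longleftrightarrow> (\<forall>e>0. \<exists>\<delta>>0. \<exists>Q. subsystem Q (X \<times> X) (map_prod T T) \<and>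
     (\<forall>a b. (a, b) \<in> Q \<longrightarrow> p a = p b \<and> dist a b \<ge> \<delta>) \<and>
     (\<forall>a\<in>X. \<forall>b\<in>X. p a = p b \<and> dist a b \<ge> e \<longrightarrow> (a, b) \<in> Q))"

lemma compact_sys_inv_into:
  assumes "compact_sys X T"
  shows "compact_sys X (inv_into X T)"
proof -
  have T: "compact X" "continuous_on X T" "inj_on T X" "T ` X = X"
    using assms by (auto simp: compact_sys_def)
  have "bij_betw T X X" using T by (simp add: bij_betw_def)
  then have "bij_betw (inv_into X T) X X" by (rule bij_betw_inv_into)
  moreover have "continuous_on X (inv_into X T)"
    using continuous_on_inv[OF T(2,1), of "inv_into X T"] T(3,4) by simp
  ultimately show ?thesis using T(1) by (simp add: compact_sys_def bij_betw_def)
qed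

lemma sys_hom_inv_into:
  assumes h: "sys_hom X T Y S p"
  shows "sys_hom X (inv_into X T) Y (inv_into Y S) p"
proof (rule sys_homI)
  show "compact_sys X (inv_into X T)" "compact_sys Y (inv_into Y S)"
    using h by (auto intro: compact_sys_inv_into sys_homD)
  show "continuous_on X p" "\<And>x. x \<in> X \<Longrightarrow> p x \<in> Y" using sys_homD[OF h] by auto
  fix x assume x: "x \<in> X"
  have T: "inj_on T X" "T ` X = X" "inj_on S Y" using sys_homD(1,2)[OF h] by (auto simp: compact_sys_def)
  obtain y where y: "y \<in> X" "x = T y" using x T by blast
  show "p (inv_into X T x) = inv_into Y S (p x)"
    using y T sys_homD(4,5)[OF h y(1)] by simp
qed

lemma sys_hom_zpow:
  assumes "sys_hom X T Y S p"
  shows "sys_hom X (zpow X T n) Y (zpow Y S n) p"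
  unfolding zpow_def using assms by (auto intro: sys_hom_funpow sys_hom_inv_into)

lemma zpow_zpow:
  assumes "inj_on T X" "T ` X = X" "x \<in> X"
  shows "zpow X T m (zpow X T n x) = zpow X T (m + n) x"
proof (induction m arbitrary: n rule: int_induct[where k = 0])
  case base
  show ?case by (simp add: zpow_def)
next
  have mem: "zpow X T n x \<in> X" for n by (rule zpow_mem) (use assms in auto)
  {
    case (step1 i)
    show ?case
      using zpow_T[OF assms(1) mem, of i n] T_zpow[OF assms(2,3), of n] step1(2)[of "n + 1"]
      by (simp add: algebra_simps)
  next
    case (step2 i)
    show ?case
      using zpow_T[OF assms(1) mem, of "i - 1" "n - 1"] T_zpow[OF assms(2,3), of "n - 1"] step2(2)[of "n - 1"]
      by (simp add: algebra_simps)
  }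
qed

text \<open>\<open>Q\<close> collects the fibre pairs whose distance is at least
  \<open>\<delta>\<close> at every integer time; ranging over all of the integers makes it
  invariant. A pair that is \<open>e\<close>-apart belongs to it: if it were closer than
  \<open>\<delta>\<close> at time \<open>n\<close>, equicontinuity applied there and read at time
  \<open>- n\<close> would bring the original pair within \<open>e\<close>.\<close>

lemma equicont_ext_imp_fibre_separated:
  assumes h: "sys_hom X T Y S p" and eq: "equicont_ext X T p"
  shows "fibre_separated X T p"
  unfolding fibre_separated_def
proof (intro allI impI)
  fix e :: real assume "e > 0"
  then obtain \<delta> where \<delta>: "\<delta> > 0" "\<And>x y n. x \<in> X \<Longrightarrow> y \<in> X \<Longrightarrow> p x = p y \<Longrightarrow> dist x y < \<delta> \<Longrightarrow>
      dist (zpow X T n x) (zpow X T n y) < e"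
    using eq unfolding equicont_ext_def by meson
  have X: "compact_sys X T" using h by (rule sys_homD)
  have T: "inj_on T X" "T ` X = X" using X by (auto simp: compact_sys_def)
  have XX: "compact_sys (X \<times> X) (map_prod T T)" by (rule compact_sys_map_prod[OF X X])
  have hz: "sys_hom X (zpow X T n) Y (zpow Y S n) p" for n by (rule sys_hom_zpow[OF h])
  define R where "R = {z \<in> X \<times> X. p (fst z) = p (snd z)}"
  define D where "D n z = dist (zpow X T n (fst z)) (zpow X T n (snd z))" for n z
  define Q where "Q = {z \<in> R. \<forall>n. \<delta> \<le> D n z}"
  have R: "subsystem R (X \<times> X) (map_prod T T)"
    unfolding R_def by (rule subsystem_equalizer[OF sys_hom_comp[OF sys_hom_fst[OF X X] h] sys_hom_comp[OF sys_hom_snd[OF X X] h]])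
  have Dsuc: "D n (map_prod T T z) = D (n + 1) z" if "z \<in> X \<times> X" for n z
    using that zpow_T[OF T(1)] by (auto simp: D_def)
  have "subsystem Q (X \<times> X) (map_prod T T)"
    unfolding subsystem_def
  proof (intro conjI)
    show "Q \<subseteq> X \<times> X" unfolding Q_def R_def by auto
    have "continuous_on R (D n)" for n
    proof -
      have "continuous_on X (zpow X T n)" using sys_homD(1)[OF hz] by (simp add: compact_sys_def)
      then have "continuous_on R (\<lambda>z. zpow X T n (fst z))" "continuous_on R (\<lambda>z. zpow X T n (snd z))"
        by (rule continuous_on_compose2; auto simp: R_def intro!: continuous_on_fst continuous_on_snd continuous_on_id)+
      then show ?thesis unfolding D_def by (rule continuous_on_dist)
    qed
    then have "closed {z \<in> R. \<delta> \<le> D n z}" for n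
      using continuous_closed_preimage[OF _ subsystemD(2)[OF R], of "D n" "{\<delta>..}"]
      by (simp add: vimage_def Int_def)
    then have "closed (\<Inter>n. {z \<in> R. \<delta> \<le> D n z})" by blast
    moreover have "(\<Inter>n. {z \<in> R. \<delta> \<le> D n z}) = Q" unfolding Q_def by auto
    ultimately show "closed Q" by simp
    show "map_prod T T ` Q = Q"
    proof
      show "map_prod T T ` Q \<subseteq> Q"
      proof
        fix w assume "w \<in> map_prod T T ` Q"
        then obtain z where z: "z \<in> R" "\<And>n. \<delta> \<le> D n z" "w = map_prod T T z"
          by (auto simp: Q_def)
        have "w \<in> R" using imageI[OF z(1), of "map_prod T T"] unfolding z(3) subsystemD(3)[OF R] .
        moreover have "\<delta> \<le> D n w" for n using z Dsuc[of z n] subsystemD(1)[OF R] by auto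
        ultimately show "w \<in> Q" unfolding Q_def by blast
      qed
      show "Q \<subseteq> map_prod T T ` Q"
      proof
        fix w assume w: "w \<in> Q"
        then have "w \<in> map_prod T T ` R" unfolding subsystemD(3)[OF R] Q_def by blast
        then obtain z where z: "w = map_prod T T z" "z \<in> R" by (rule imageE)
        have "\<delta> \<le> D n z" for n
        proof -
          have "\<delta> \<le> D (n - 1) w" using w unfolding Q_def by blast
          then show ?thesis using Dsuc[of z "n - 1"] z subsystemD(1)[OF R] by auto
        qed
        then have "z \<in> Q" using z unfolding Q_def by blast
        then show "w \<in> map_prod T T ` Q" unfolding z(1) by (rule imageI)
      qed
    qed
  qed
  moreover have "p a = p b \<and> \<delta> \<le> dist a b" if ab: "(a, b) \<in> Q" for a b
  proof -
    have "\<delta> \<le> D 0 (a, b)" "p a = p b" using ab unfolding Q_def R_def by auto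
    then show ?thesis by (simp add: D_def zpow_def)
  qed
  moreover have "(a, b) \<in> Q" if a: "a \<in> X" and b: "b \<in> X" and ab: "p a = p b" "e \<le> dist a b" for a b
  proof -
    have "\<delta> \<le> dist (zpow X T n a) (zpow X T n b)" for n
    proof (rule ccontr)
      assume "\<not> ?thesis"
      then have lt: "dist (zpow X T n a) (zpow X T n b) < \<delta>" by simp
      have mem: "zpow X T n a \<in> X" "zpow X T n b \<in> X" using a b T by (auto intro!: zpow_mem)
      have "p (zpow X T n a) = p (zpow X T n b)"
        using sys_homD(5)[OF hz a] sys_homD(5)[OF hz b] ab by metis
      from \<delta>(2)[OF mem this lt, of "- n"]
      have "dist (zpow X T (- n) (zpow X T n a)) (zpow X T (- n) (zpow X T n b)) < e" .
      moreover have "zpow X T (- n) (zpow X T n c) = c" if "c \<in> X" for c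
        using zpow_zpow[OF T that, of "- n" n] by (simp add: zpow_def)
      ultimately show False using a b ab by simp
    qed
    then show ?thesis using a b ab unfolding Q_def R_def D_def by simp
  qed
  ultimately show "\<exists>\<delta>>0. \<exists>Q. subsystem Q (X \<times> X) (map_prod T T) \<and>
     (\<forall>a b. (a, b) \<in> Q \<longrightarrow> p a = p b \<and> dist a b \<ge> \<delta>) \<and>
     (\<forall>a\<in>X. \<forall>b\<in>X. p a = p b \<and> dist a b \<ge> e \<longrightarrow> (a, b) \<in> Q)"
    using \<delta>(1) by blast
qed

section \<open>Comparison of the metric on a power with the coordinate distances\<close>

lemma power_sys_dist_less:
  assumes "e > 0"
  shows "\<exists>e'>0. \<forall>a\<in>power_sys d X. \<forall>b\<in>power_sys d X. (\<forall>l<d. dist (a l) (b l) < e') \<longrightarrow>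
    dist a b < (e::real)"
proof -
  obtain N where N: "(1 / 2) ^ N < e / 2" using assms real_arch_pow_inv[of "e / 2" "1 / 2"] by auto
  have "dist a b < e"
    if a: "a \<in> power_sys d X" and b: "b \<in> power_sys d X" and lt: "\<forall>l<d. dist (a l) (b l) < e / 4" for a b
  proof -
    \<comment> \<open>The metric on functions is at most twice the maximum over the first indices
      plus a tail \<open>(1 / 2) ^ N\<close>, which gives \<open>2 * (e / 4)\<close> plus less than
      \<open>e / 2\<close>. Beyond \<open>d\<close> both entries are \<open>undefined\<close>, at
      distance 0.\<close>
    have "dist (a i) (b i) \<le> e / 4" for i
      using lt a b assms by (cases "i < d") (auto simp: power_sys_def PiE_def extensional_def less_imp_le)
    then have "Max {dist (a (from_nat n)) (b (from_nat n)) |n. n \<le> N} \<le> e / 4"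
      by (subst Max_le_iff) auto
    then show ?thesis using dist_fun_le_dist_first_terms[of a b N] N by linarith
  qed
  then show ?thesis using assms by (intro exI[of _ "e / 4"]) auto
qed

lemma power_sys_coordinate_dist_less:
  assumes X: "compact X" and "\<delta> > 0"
  shows "\<exists>\<delta>'>0. \<forall>a\<in>power_sys d X. \<forall>b\<in>power_sys d X. dist a b < \<delta>' \<longrightarrow>
    (\<forall>l<d. dist (a l) (b l) < \<delta>)"
proof -
  have "\<exists>f>0. \<forall>a\<in>power_sys d X. \<forall>b\<in>power_sys d X. dist a b < f \<longrightarrow> dist (a l) (b l) < \<delta>" for l
  proof -
    have "continuous_on (power_sys d X) (\<lambda>x. x l)"
      by (rule continuous_on_subset[OF continuous_on_product_coordinates]) auto
    then have "uniformly_continuous_on (power_sys d X) (\<lambda>x. x l)"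
      by (rule compact_uniformly_continuous) (rule compact_power_sys[OF X])
    then show ?thesis using \<open>\<delta> > 0\<close> unfolding uniformly_continuous_on_def by (metis dist_commute)
  qed
  then obtain f where f: "\<And>l. f l > 0" "\<And>l a b. a \<in> power_sys d X \<Longrightarrow> b \<in> power_sys d X \<Longrightarrow>
      dist a b < f l \<Longrightarrow> dist (a l) (b l) < \<delta>" by metis
  show ?thesis
  proof (intro exI[of _ "Min (insert 1 (f ` {..<d}))"] conjI ballI impI allI)
    show "0 < Min (insert 1 (f ` {..<d}))" using f(1) by auto
    fix a b l assume "a \<in> power_sys d X" "b \<in> power_sys d X" "dist a b < Min (insert 1 (f ` {..<d}))" "l < d"
    then show "dist (a l) (b l) < \<delta>" by (intro f(2)) auto
  qed
qed

lemma subsystem_funpow: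
  assumes "subsystem A X T"
  shows "subsystem A X (T ^^ n)"
proof -
  have "(T ^^ n) ` A = A"
    using subsystemD(3)[OF assms] by (induction n) (simp, simp only: funpow.simps image_comp[symmetric])
  then show ?thesis using assms by (simp add: subsystem_def)
qed

lemma map_prod_funpow:
  fixes T :: "'a \<Rightarrow> 'a" and S :: "'b \<Rightarrow> 'b"
  shows "map_prod T S ^^ n = map_prod (T ^^ n) (S ^^ n)"
  by (induction n) (auto simp: fun_eq_iff)

text \<open>Tuples that are far apart are far apart in some coordinate, so the separating set is the
  part of the fibre product where some coordinate pair lies in \<open>Q\<close>. The union is
  finite, hence closed, and the differing powers do no harm because \<open>Q\<close> is invariant
  under each power of \<open>map_prod T T\<close>.\<close>

lemma fibre_separated_tau:
  assumes h: "sys_hom X T Y S p" and sep: "fibre_separated X T p"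
  shows "fibre_separated (power_sys d X) (tau d T) (cmap d (\<lambda>_. p))"
  unfolding fibre_separated_def
proof (intro allI impI)
  let ?P = "power_sys d X" and ?t = "tau d T" and ?p = "cmap d (\<lambda>_. p)"
  fix e :: real assume "e > 0"
  then obtain e' where e': "e' > 0" "\<And>a b. a \<in> ?P \<Longrightarrow> b \<in> ?P \<Longrightarrow> \<forall>l<d. dist (a l) (b l) < e' \<Longrightarrow> dist a b < e"
    using power_sys_dist_less[of e d X] by blast
  obtain \<delta> Q where \<delta>: "\<delta> > 0" and Q: "subsystem Q (X \<times> X) (map_prod T T)"
    "\<And>a b. (a, b) \<in> Q \<Longrightarrow> \<delta> \<le> dist a b"
    "\<And>a b. a \<in> X \<Longrightarrow> b \<in> X \<Longrightarrow> p a = p b \<Longrightarrow> e' \<le> dist a b \<Longrightarrow> (a, b) \<in> Q"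
    using sep e'(1) unfolding fibre_separated_def by meson
  have X: "compact_sys X T" using h by (rule sys_homD)
  then have "compact X" by (simp add: compact_sys_def)
  then obtain \<delta>' where \<delta>': "\<delta>' > 0" "\<And>a b l. a \<in> ?P \<Longrightarrow> b \<in> ?P \<Longrightarrow> dist a b < \<delta>' \<Longrightarrow> l < d \<Longrightarrow>
      dist (a l) (b l) < \<delta>"
    using power_sys_coordinate_dist_less[OF _ \<delta>, of X d] by blast
  have P: "compact_sys ?P ?t" using X by (rule compact_sys_tau)
  have PP: "compact_sys (?P \<times> ?P) (map_prod ?t ?t)" by (rule compact_sys_map_prod[OF P P])
  note fst = sys_hom_fst[OF P P] and snd = sys_hom_snd[OF P P]
  define R where "R = {z \<in> ?P \<times> ?P. ?p (fst z) = ?p (snd z)}"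
  define V where "V l = {z \<in> ?P \<times> ?P. (fst z l, snd z l) \<in> Q}" for l
  have R: "subsystem R (?P \<times> ?P) (map_prod ?t ?t)"
    unfolding R_def
    by (rule subsystem_equalizer[OF sys_hom_comp[OF fst sys_hom_tau[OF h]] sys_hom_comp[OF snd sys_hom_tau[OF h]]])
  have "subsystem (V l) (?P \<times> ?P) (map_prod ?t ?t)" if l: "l < d" for l
  proof -
    note fl = sys_hom_comp[OF fst sys_hom_tau_coordinate[OF X l]]
      and sl = sys_hom_comp[OF snd sys_hom_tau_coordinate[OF X l]]
    have "subsystem Q (X \<times> X) (map_prod (T ^^ Suc l) (T ^^ Suc l))"
      using subsystem_funpow[OF Q(1)] map_prod_funpow by metis
    then show ?thesis unfolding V_def by (rule subsystem_vimage[OF sys_hom_Pair[OF fl sl]])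
  qed
  then have "subsystem (R \<inter> (\<Union>l\<in>{..<d}. V l)) (?P \<times> ?P) (map_prod ?t ?t)"
    by (intro subsystem_Int[OF PP R] subsystem_UN_finite) auto
  moreover have "?p a = ?p b \<and> \<delta>' \<le> dist a b" if ab: "(a, b) \<in> R \<inter> (\<Union>l\<in>{..<d}. V l)" for a b
  proof -
    obtain l where "l < d" "(a l, b l) \<in> Q" and P': "a \<in> ?P" "b \<in> ?P" "?p a = ?p b"
      using ab by (auto simp: R_def V_def)
    then have "\<not> dist a b < \<delta>'" using Q(2) \<delta>'(2) by (meson not_less)
    then show ?thesis using P' by simp
  qed
  moreover have "(a, b) \<in> R \<inter> (\<Union>l\<in>{..<d}. V l)"
    if a: "a \<in> ?P" and b: "b \<in> ?P" and ab: "?p a = ?p b" "e \<le> dist a b" for a b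
  proof -
    obtain l where l: "l < d" "e' \<le> dist (a l) (b l)" using e'(2)[OF a b] ab(2) by (meson not_less)
    have "p (a l) = p (b l)" using fun_cong[OF ab(1), of l] l by (simp add: cmap_def)
    then have "(a l, b l) \<in> Q" using l power_sysD[OF a] power_sysD[OF b] by (intro Q(3)) auto
    then show ?thesis using a b ab l(1) by (auto simp: R_def V_def)
  qed
  ultimately show "\<exists>\<delta>>0. \<exists>Q. subsystem Q (?P \<times> ?P) (map_prod ?t ?t) \<and>
     (\<forall>a b. (a, b) \<in> Q \<longrightarrow> ?p a = ?p b \<and> dist a b \<ge> \<delta>) \<and>
     (\<forall>a\<in>?P. \<forall>b\<in>?P. ?p a = ?p b \<and> dist a b \<ge> e \<longrightarrow> (a, b) \<in> Q)"
    using \<delta>'(1) by blast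
qed

lemma separated_finite_bound:
  fixes X :: "'a::metric_space set"
  assumes "compact X" "\<delta> > 0"
  obtains K where "\<And>g. (\<And>i. i < Suc K \<Longrightarrow> g i \<in> X) \<Longrightarrow>
    \<exists>i<Suc K. \<exists>j<Suc K. i \<noteq> j \<and> dist (g i) (g j) < \<delta>"
proof -
  obtain C where C: "finite C" "X \<subseteq> (\<Union>c\<in>C. ball c (\<delta> / 2))"
    using assms compact_eq_totally_bounded[of X] by (meson half_gt_zero)
  have "\<exists>i<Suc (card C). \<exists>j<Suc (card C). i \<noteq> j \<and> dist (g i) (g j) < \<delta>"
    if g: "\<And>i. i < Suc (card C) \<Longrightarrow> g i \<in> X" for g
  proof -
    have "\<forall>i\<in>{..<Suc (card C)}. \<exists>c. c \<in> C \<and> dist c (g i) < \<delta> / 2" using g C(2) by fastforce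
    then obtain f where f: "\<forall>i\<in>{..<Suc (card C)}. f i \<in> C \<and> dist (f i) (g i) < \<delta> / 2"
      using bchoice by metis
    then have "f ` {..<Suc (card C)} \<subseteq> C" by blast
    then have "card (f ` {..<Suc (card C)}) \<le> card C" by (rule card_mono[OF C(1)])
    then have "card (f ` {..<Suc (card C)}) < card {..<Suc (card C)}" by simp
    then have "\<not> inj_on f {..<Suc (card C)}" by (rule pigeonhole)
    then obtain i j where ij: "i < Suc (card C)" "j < Suc (card C)" "i \<noteq> j" "f i = f j"
      unfolding inj_on_def by auto
    then have "dist (f i) (g i) < \<delta> / 2" "dist (f i) (g j) < \<delta> / 2"
      using bspec[OF f, of i] bspec[OF f, of j] by simp_all
    then have "dist (g i) (g j) < \<delta>" by (rule dist_triangle_half_r)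
    then show ?thesis using ij by blast
  qed
  then show ?thesis using that by blast
qed

text \<open>A point \<open>x \<notin> M\<close> in a fibre could be added to any separated tuple of \<open>M\<close> in the same
  fibre; moving \<open>x\<close> into \<open>M\<close> along its orbit closure keeps the tuple separated, so \<open>M\<close> would
  contain arbitrarily long separated tuples.\<close>

lemma fibre_separated_transitive_point:
  assumes h: "sys_hom X T Y S p" and sep: "fibre_separated X T p"
    and M: "minimal_sub M X T" and x: "x \<in> X" "p x \<in> p ` M"
    and trans: "\<And>A. subsystem A X T \<Longrightarrow> x \<in> A \<Longrightarrow> M \<subseteq> A"
  shows "x \<in> M"
proof (rule ccontr)
  assume "x \<notin> M"
  have X: "compact_sys X T" using h by (rule sys_homD)
  then have cX: "compact X" by (simp add: compact_sys_def)
  have cM: "closed M" using subsystemD(2)[OF minimal_subD(1)[OF M]] .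
  obtain e where e: "e > 0" "\<And>m. m \<in> M \<Longrightarrow> e \<le> dist x m"
  proof -
    obtain r where "r > 0" "ball x r \<subseteq> - M"
      using cM \<open>x \<notin> M\<close> by (meson ComplI closed_open openE)
    then show thesis using that[of r] by (force simp: not_less[symmetric])
  qed
  obtain \<delta> Q where \<delta>: "\<delta> > 0" and Q: "subsystem Q (X \<times> X) (map_prod T T)"
    "\<And>a b. (a, b) \<in> Q \<Longrightarrow> p a = p b \<and> \<delta> \<le> dist a b"
    "\<And>a b. a \<in> X \<Longrightarrow> b \<in> X \<Longrightarrow> p a = p b \<Longrightarrow> e \<le> dist a b \<Longrightarrow> (a, b) \<in> Q"
    using sep e(1) unfolding fibre_separated_def by meson
  \<comment> \<open>The tuples here are auxiliary: \<open>T\<close> acts in the same way on every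
    coordinate, so that membership of coordinate pairs in \<open>Q\<close> is an invariant
    condition.\<close>
  let ?P = "\<lambda>k. power_sys k X" and ?t = "\<lambda>k. cmap k (\<lambda>_. T)"
  have P: "compact_sys (?P k) (?t k)" for k by (rule compact_sys_cmap) (auto simp: X cX)
  have coord: "sys_hom (?P k) (?t k) X T (\<lambda>g. g i)" if "i < k" for k i
    using sys_hom_coordinate[OF that, of X "\<lambda>_. T"] X cX by simp
  \<comment> \<open>Tuples of \<open>k\<close> points in one fibre, pairwise separated by
    \<open>\<delta>\<close>, of which the first \<open>m\<close> points lie in \<open>M\<close>. The
    condition through \<open>Q\<close> replaces one on distances so that \<open>C k m\<close> is
    closed and invariant.\<close>
  define C where "C k m = {g \<in> ?P k. (\<forall>i<m. g i \<in> M) \<and> (\<forall>i<k. \<forall>j<k. i \<noteq> j \<longrightarrow> (g i, g j) \<in> Q)}" for k m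
  have C: "subsystem (C k m) (?P k) (?t k)" if "m \<le> k" for k m
  proof -
    let ?F = "(\<lambda>i. {g \<in> ?P k. g i \<in> M}) ` {..<m} \<union>
      (\<lambda>(i, j). {g \<in> ?P k. (g i, g j) \<in> Q}) ` {(i, j). i < k \<and> j < k \<and> i \<noteq> j}"
    have "subsystem (?P k \<inter> \<Inter>?F) (?P k) (?t k)"
    proof (rule subsystem_Inter[OF P])
      have "subsystem {g \<in> ?P k. g i \<in> M} (?P k) (?t k)" if "i < k" for i
        by (rule subsystem_vimage[OF coord[OF that] minimal_subD(1)[OF M]])
      moreover have "subsystem {g \<in> ?P k. (g i, g j) \<in> Q} (?P k) (?t k)" if "i < k" "j < k" for i j
        by (rule subsystem_vimage[OF sys_hom_Pair[OF coord[OF that(1)] coord[OF that(2)]] Q(1)])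
      ultimately show "subsystem A (?P k) (?t k)" if "A \<in> ?F" for A using that \<open>m \<le> k\<close> by auto
    qed
    moreover have "?P k \<inter> \<Inter>?F = C k m" unfolding C_def by auto
    ultimately show ?thesis by simp
  qed
  have "C (Suc k) (Suc k) \<noteq> {}" for k
  proof (induction k)
    case 0
    obtain m where "m \<in> M" using minimal_subD(2)[OF M] by blast
    then have "(\<lambda>i. if i < Suc 0 then m else undefined) \<in> C (Suc 0) (Suc 0)"
      using minimal_subD(3)[OF M] unfolding C_def by (auto intro!: power_sysI)
    then show ?case by blast
  next
    case (Suc k)
    have "p ` M \<subseteq> (\<lambda>g. p (g 0)) ` C (Suc k) (Suc k)"
    proof (rule minimal_sub_subset[OF sys_homD(2)[OF h] minimal_sub_image[OF h M]])
      show "subsystem ((\<lambda>g. p (g 0)) ` C (Suc k) (Suc k)) Y S"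
        by (rule subsystem_image[OF sys_hom_comp[OF coord h] C]) auto
      show "p ` M \<inter> (\<lambda>g. p (g 0)) ` C (Suc k) (Suc k) \<noteq> {}"
        using Suc unfolding C_def by blast
    qed
    then have "p x \<in> (\<lambda>g. p (g 0)) ` C (Suc k) (Suc k)" using x(2) by (rule subsetD)
    then obtain g where g: "g \<in> C (Suc k) (Suc k)" "p (g 0) = p x" by force
    have gM: "g i \<in> M" if "i < Suc k" for i using g(1) that by (simp add: C_def)
    have gp: "p (g i) = p x" if "i < Suc k" for i
    proof (cases "i = 0")
      case False
      then have "(g i, g 0) \<in> Q" using g(1) that by (simp add: C_def)
      then show ?thesis using Q(2) g(2) by metis
    qed (use g in simp)
    \<comment> \<open>Both orders are recorded, since \<open>C\<close> refers to ordered pairs and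
      \<open>Q\<close> is not known to be symmetric.\<close>
    have gx: "(g i, x) \<in> Q" "(x, g i) \<in> Q" if "i < Suc k" for i
      using gM[OF that] gp[OF that] e(2)[OF gM[OF that]] x(1) minimal_subD(3)[OF M]
      by (auto intro!: Q(3) simp: dist_commute)
    define g' where "g' = g(Suc k := x)"
    have "g' \<in> C (Suc (Suc k)) (Suc k)"
    proof -
      have "g' \<in> ?P (Suc (Suc k))"
      proof (rule power_sysI)
        show "g' i \<in> X" if "i < Suc (Suc k)" for i
          using gM minimal_subD(3)[OF M] x(1) that by (cases "i = Suc k") (auto simp: g'_def)
        show "g' i = undefined" if "Suc (Suc k) \<le> i" for i
          using g(1) that by (auto simp: g'_def C_def power_sys_def PiE_def extensional_def)
      qed
      moreover have "(g' i, g' j) \<in> Q" if "i < Suc (Suc k)" "j < Suc (Suc k)" "i \<noteq> j" for i j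
        using that gx g(1) by (cases "i = Suc k"; cases "j = Suc k") (auto simp: g'_def C_def)
      ultimately show ?thesis using gM unfolding C_def by (auto simp: g'_def)
    qed
    \<comment> \<open>The possible last entries form a closed invariant set containing
      \<open>x\<close>, hence all of \<open>M\<close>. So some tuple has its last entry in
      \<open>M\<close> as well.\<close>
    then have "x \<in> (\<lambda>g. g (Suc k)) ` C (Suc (Suc k)) (Suc k)"
      by (rule image_eqI[rotated]) (simp add: g'_def)
    moreover have "subsystem ((\<lambda>g. g (Suc k)) ` C (Suc (Suc k)) (Suc k)) X T"
      by (rule subsystem_image[OF coord C]) auto
    ultimately have "M \<subseteq> (\<lambda>g. g (Suc k)) ` C (Suc (Suc k)) (Suc k)" using trans by blast
    then obtain f where f: "f \<in> C (Suc (Suc k)) (Suc k)" "f (Suc k) \<in> M"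
      using minimal_subD(2)[OF M] by blast
    then have "f \<in> C (Suc (Suc k)) (Suc (Suc k))" unfolding C_def by (auto simp: less_Suc_eq)
    then show ?case by blast
  qed
  moreover obtain K where K: "\<And>g. (\<And>i. i < Suc K \<Longrightarrow> g i \<in> X) \<Longrightarrow>
      \<exists>i<Suc K. \<exists>j<Suc K. i \<noteq> j \<and> dist (g i) (g j) < \<delta>"
    using separated_finite_bound[OF cX \<delta>] by blast
  ultimately obtain g where g: "g \<in> C (Suc K) (Suc K)" by blast
  then have "g i \<in> X" if "i < Suc K" for i using that unfolding C_def by (auto intro: power_sysD)
  then obtain i j where ij: "i < Suc K" "j < Suc K" "i \<noteq> j" "dist (g i) (g j) < \<delta>" using K by blast
  then have "(g i, g j) \<in> Q" using g unfolding C_def by blast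
  then show False using Q(2) ij(4) by fastforce
qed

lemma minimal_of_fibre_separated:
  assumes h: "sys_hom X T Y S p" and sep: "fibre_separated X T p"
    and Z: "M_sub Z X T" and m: "minimal_sub (p ` Z) Y S"
  shows "minimal_sub Z X T"
proof -
  have X: "compact_sys X T" using h by (rule sys_homD)
  obtain x where x: "x \<in> Z" "\<And>A. subsystem A X T \<Longrightarrow> x \<in> A \<Longrightarrow> Z \<subseteq> A" and sZ: "subsystem Z X T"
    using Z unfolding M_sub_def by blast
  have "Z \<noteq> {}" using x(1) by blast
  with sZ obtain M where M: "minimal_sub M X T" "M \<subseteq> Z" by (rule minimal_sub_exists[OF X])
  have "p ` M \<inter> p ` Z \<noteq> {}" using M(2) minimal_subD(2)[OF M(1)] by blast
  then have "p ` M = p ` Z" by (rule minimal_sub_eq[OF sys_homD(2)[OF h] minimal_sub_image[OF h M(1)] m])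
  then have "x \<in> M"
    using x M(2) subsystemD(1)[OF sZ] by (intro fibre_separated_transitive_point[OF h sep M(1)]) blast+
  then have "Z \<subseteq> M" by (rule x(2)[OF minimal_subD(1)[OF M(1)]])
  then show ?thesis using M by (simp add: subset_antisym)
qed

section \<open>Towers\<close>

text \<open>Given \<open>z\<close> in \<open>Z\<close>, minimality of each image provides a point of
  \<open>A\<close> that agrees with \<open>z\<close> under \<open>p i\<close>. These agreement sets
  are compact and nested, since the maps are linearly ordered by refinement, and a common point must
  be \<open>z\<close> itself.\<close>

lemma minimal_of_separating_chain:
  assumes X: "compact_sys X T" and Z: "subsystem Z X T" "Z \<noteq> {}" and I: "I \<noteq> {}"
    and h: "\<And>i. i \<in> I \<Longrightarrow> sys_hom X T (Y i) (S i) (p i)"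
    and m: "\<And>i. i \<in> I \<Longrightarrow> minimal_sub (p i ` Z) (Y i) (S i)"
    and chain: "\<And>i j. i \<in> I \<Longrightarrow> j \<in> I \<Longrightarrow>
      (\<forall>x\<in>X. \<forall>y\<in>X. p i x = p i y \<longrightarrow> p j x = p j y) \<or> (\<forall>x\<in>X. \<forall>y\<in>X. p j x = p j y \<longrightarrow> p i x = p i y)"
    and sep: "\<And>x y. x \<in> X \<Longrightarrow> y \<in> X \<Longrightarrow> (\<And>i. i \<in> I \<Longrightarrow> p i x = p i y) \<Longrightarrow> x = y"
  shows "minimal_sub Z X T"
proof (rule minimal_subI[OF Z])
  fix A assume A: "subsystem A X T" "A \<noteq> {}" "A \<subseteq> Z"
  show "Z \<subseteq> A"
  proof
    fix z assume z: "z \<in> Z"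
    have zX: "z \<in> X" and AX: "A \<subseteq> X" using z Z(1) A(1) by (auto dest: subsystemD)
    define F where "F i = {a \<in> A. p i a = p i z}" for i
    have "\<Inter>(F ` I) \<noteq> {}"
    proof (rule compact_chain_Inter_nonempty)
      show "F ` I \<noteq> {}" using I by simp
      show "{} \<notin> F ` I"
      proof
        assume "{} \<in> F ` I"
        then obtain i where i: "i \<in> I" "F i = {}" by auto
        have "p i ` Z \<subseteq> p i ` A"
          using A by (intro minimal_sub_subset[OF sys_homD(2)[OF h[OF i(1)]] m[OF i(1)] subsystem_image[OF h[OF i(1)]]]) auto
        then have "p i z \<in> p i ` A" using z by blast
        then show False using i(2) unfolding F_def by force
      qed
      fix B assume "B \<in> F ` I"
      then obtain i where i: "i \<in> I" "B = F i" by blast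
      have "compact A" by (rule subsystem_compact[OF X A(1)])
      moreover have "continuous_on A (p i)"
        using sys_homD(3)[OF h[OF i(1)]] AX by (rule continuous_on_subset)
      then have "closed {a \<in> A. p i a \<in> {p i z}}"
        using continuous_closed_preimage[OF _ subsystemD(2)[OF A(1)], of "p i" "{p i z}"]
        by (simp add: vimage_def Int_def)
      ultimately have "compact (A \<inter> {a \<in> A. p i a \<in> {p i z}})" by (rule compact_Int_closed)
      moreover have "A \<inter> {a \<in> A. p i a \<in> {p i z}} = B" unfolding i(2) F_def by blast
      ultimately show "compact B" by simp
      fix D assume "D \<in> F ` I"
      then obtain j where j: "j \<in> I" "D = F j" by blast
      show "B \<subseteq> D \<or> D \<subseteq> B"
        using chain[OF i(1) j(1)] zX AX unfolding i(2) j(2) F_def by blast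
    qed
    then obtain a where a: "\<And>i. i \<in> I \<Longrightarrow> a \<in> F i" by blast
    then have "a \<in> A" using I unfolding F_def by blast
    moreover have "a = z" using a AX zX \<open>a \<in> A\<close> unfolding F_def by (intro sep) auto
    ultimately show "z \<in> A" by simp
  qed
qed

lemma cmap_cmap: "cmap d F (cmap d G x) = cmap d (\<lambda>i u. F i (G i u)) x"
  by (simp add: cmap_def fun_eq_iff)

lemma cmap_cong:
  assumes "x \<in> power_sys d X" "\<And>i u. i < d \<Longrightarrow> u \<in> X \<Longrightarrow> F i u = G i u"
  shows "cmap d F x = cmap d G x"
  using assms power_sysD[OF assms(1)] by (simp add: cmap_def fun_eq_iff)

lemma strictly_PI_tower_minimal:
  assumes tower: "strictly_PI_tower r z e W S p"
    and Z: "M_sub Z (power_sys d (W e)) (tau d (S e))"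
  shows "minimal_sub Z (power_sys d (W e)) (tau d (S e))"
proof -
  have wo: "Well_order r" and zF: "z \<in> Field r" and eF: "e \<in> Field r"
    and ze: "\<And>i. i \<in> Field r \<Longrightarrow> (z, i) \<in> r \<and> (i, e) \<in> r"
    and tds: "\<And>i. i \<in> Field r \<Longrightarrow> tds (W i) (S i)"
    and triv: "\<exists>w. W z = {w}"
    and fac: "\<And>i j. (i, j) \<in> r \<Longrightarrow> factor_map (W j) (S j) (W i) (S i) (p j i)"
    and pid: "\<And>i x. i \<in> Field r \<Longrightarrow> x \<in> W i \<Longrightarrow> p i i x = x"
    and pp: "\<And>i j k x. (i, j) \<in> r \<Longrightarrow> (j, k) \<in> r \<Longrightarrow> x \<in> W k \<Longrightarrow> p j i (p k j x) = p k i x"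
    and succ: "\<And>i j. is_succ r i j \<Longrightarrow>
        proximal_ext (W j) (S j) (p j i) \<or> equicont_ext (W j) (S j) (p j i)"
    and lim: "\<And>v. is_limit r z v \<Longrightarrow> inverse_limit_at r W p v"
    using tower unfolding strictly_PI_tower_def by blast+
  have tot: "(i, j) \<in> r \<or> (j, i) \<in> r" if "i \<in> Field r" "j \<in> Field r" for i j
    using wo that unfolding order_on_defs total_on_def refl_on_def by metis
  have wf: "wf (r - Id)" using wo by (simp add: well_order_on_def)
  have h: "sys_hom (W j) (S j) (W i) (S i) (p j i)" if "(i, j) \<in> r" for i j
    using that fac tds by (blast intro: factor_map_imp_sys_hom FieldI1 FieldI2)
  let ?P = "\<lambda>i. power_sys d (W i)" and ?t = "\<lambda>i. tau d (S i)"
    and ?p = "\<lambda>j i. cmap d (\<lambda>_. p j i)"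
  have ht: "sys_hom (?P j) (?t j) (?P i) (?t i) (?p j i)" if "(i, j) \<in> r" for i j
    by (rule sys_hom_tau[OF h[OF that]])
  define V where "V i = ?p e i ` Z" for i
  have sZ: "Z \<subseteq> ?P e" and neZ: "Z \<noteq> {}" using Z unfolding M_sub_def by (auto dest: subsystemD)
  have V: "M_sub (V i) (?P i) (?t i)" if "i \<in> Field r" for i
    unfolding V_def using ze[OF that] by (intro M_sub_image[OF ht Z]) simp
  have pV: "?p j i ` V j = V i" if ij: "(i, j) \<in> r" for i j
  proof -
    have "(j, e) \<in> r" using ze ij by (blast intro: FieldI2)
    then have "?p j i (?p e j x) = ?p e i x" if "x \<in> Z" for x
      unfolding cmap_cmap using that sZ pp[OF ij] by (intro cmap_cong[where X = "W e"]) auto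
    then show ?thesis unfolding V_def image_image by (rule image_cong[OF refl])
  qed
  have "minimal_sub (V i) (?P i) (?t i)" if "i \<in> Field r" for i
    using wf that
  proof (induction i rule: wf_induct_rule)
    case (less i)
    have IH: "minimal_sub (V j) (?P j) (?t j)" if "(j, i) \<in> r" "j \<noteq> i" for j
      using less that by (blast intro: FieldI1)
    have sV: "subsystem (V i) (?P i) (?t i)" "V i \<noteq> {}"
      using V[OF less(2)] neZ unfolding M_sub_def V_def by auto
    \<comment> \<open>If \<open>i\<close> is neither least nor a limit, some \<open>j\<close> below
      it has nothing strictly between, and totality of \<open>r\<close> makes \<open>i\<close> the
      successor of \<open>j\<close>.\<close>
    consider "i = z" | "i \<noteq> z" "is_limit r z i" | j where "is_succ r j i"
    proof (cases "i = z \<or> is_limit r z i")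
      case False
      then obtain j where j: "(j, i) \<in> r" "j \<noteq> i"
        "\<And>k. (j, k) \<in> r \<Longrightarrow> j \<noteq> k \<Longrightarrow> (k, i) \<in> r \<Longrightarrow> k = i"
        using less(2) unfolding is_limit_def by blast
      have "(i, k) \<in> r" if "(j, k) \<in> r" "j \<noteq> k" for k
        using j(3)[OF that] tot[OF less(2), of k] that tot[OF less(2) less(2)] by (blast intro: FieldI2)
      then have "is_succ r j i" using j unfolding is_succ_def by blast
      then show ?thesis using that by blast
    qed (use that in blast)
    then show ?case
    proof cases
      case 1
      \<comment> \<open>The power of a one-point space is a point, so every nonempty subset of
        \<open>V i\<close> is everything.\<close>
      obtain w where w: "W z = {w}" using triv by blast
      show ?thesis
      proof (rule minimal_subI[OF sV])
        fix A assume A: "subsystem A (?P i) (?t i)" "A \<noteq> {}" "A \<subseteq> V i"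
        obtain a where a: "a \<in> A" using A(2) by blast
        have "x = a" if "x \<in> V i" for x
        proof (rule power_sys_ext)
          show x: "x \<in> ?P z" and a': "a \<in> ?P z"
            using that a A(3) subsystemD(1)[OF sV(1)] 1 by auto
          show "x l = a l" if "l < d" for l
            using power_sysD[OF x that] power_sysD[OF a' that] w by simp
        qed
        then show "V i \<subseteq> A" using a by blast
      qed
    next
      case 2
      let ?I = "{j. (j, i) \<in> r \<and> j \<noteq> i}"
      show ?thesis
      proof (rule minimal_of_separating_chain[where I = ?I])
        show "compact_sys (?P i) (?t i)" using tds[OF less(2)] by (intro compact_sys_tau tds_imp_compact_sys)
        show "subsystem (V i) (?P i) (?t i)" "V i \<noteq> {}" by (fact sV)+
        show "?I \<noteq> {}" using 2(1) ze[OF less(2)] by auto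
        show "sys_hom (?P i) (?t i) (?P j) (?t j) (?p i j)" if "j \<in> ?I" for j using that ht by blast
        show "minimal_sub (?p i j ` V i) (?P j) (?t j)" if "j \<in> ?I" for j
          using that IH pV[of j i] by simp
        have factor: "?p i k x = ?p i k y"
          if "(k, j) \<in> r" "(j, i) \<in> r" "x \<in> ?P i" "y \<in> ?P i" "?p i j x = ?p i j y" for j k x y
        proof -
          have "?p j k (?p i j u) = ?p i k u" if "u \<in> ?P i" for u
            unfolding cmap_cmap using that pp[OF \<open>(k, j) \<in> r\<close> \<open>(j, i) \<in> r\<close>]
            by (intro cmap_cong[where X = "W i"]) auto
          then show ?thesis using that by metis
        qed
        show "(\<forall>x\<in>?P i. \<forall>y\<in>?P i. ?p i j x = ?p i j y \<longrightarrow> ?p i k x = ?p i k y) \<or>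
            (\<forall>x\<in>?P i. \<forall>y\<in>?P i. ?p i k x = ?p i k y \<longrightarrow> ?p i j x = ?p i j y)"
          if "j \<in> ?I" "k \<in> ?I" for j k
        proof -
          have "(j, k) \<in> r \<or> (k, j) \<in> r" using that by (intro tot) (auto intro: FieldI1)
          then show ?thesis using factor that by blast
        qed
        show "x = y" if x: "x \<in> ?P i" and y: "y \<in> ?P i" and xy: "\<And>j. j \<in> ?I \<Longrightarrow> ?p i j x = ?p i j y" for x y
        proof (rule power_sys_ext[OF x y])
          fix l assume l: "l < d"
          have "p i j (x l) = p i j (y l)" if "(j, i) \<in> r \<and> j \<noteq> i" for j
            using fun_cong[OF xy[of j], of l] that l by (simp add: cmap_def)
          \<comment> \<open>Points of the inverse limit are determined by their images at earlier
            stages, applied to each coordinate separately.\<close>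
          then show "x l = y l"
            using lim[OF 2(2)] power_sysD[OF x l] power_sysD[OF y l] unfolding inverse_limit_at_def by blast
        qed
      qed
    next
      case (3 j)
      then have ji: "(j, i) \<in> r" "j \<noteq> i" by (auto simp: is_succ_def)
      have m: "minimal_sub (?p i j ` V i) (?P j) (?t j)" using IH[OF ji] pV[OF ji(1)] by simp
      from succ[OF 3] show ?thesis
      proof
        assume "proximal_ext (W i) (S i) (p i j)"
        then show ?thesis
          by (rule minimal_of_faithful[OF ht[OF ji(1)]
                proximal_ext_imp_minimal_faithful[OF h[OF ji(1)]] V[OF less(2)] m])
      next
        assume "equicont_ext (W i) (S i) (p i j)"
        then have "fibre_separated (?P i) (?t i) (?p i j)"
          by (intro fibre_separated_tau[OF h[OF ji(1)]] equicont_ext_imp_fibre_separated[OF h[OF ji(1)]])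
        then show ?thesis by (rule minimal_of_fibre_separated[OF ht[OF ji(1)] _ V[OF less(2)] m])
      qed
    qed
  qed
  from this[OF eF] have "minimal_sub (V e) (?P e) (?t e)" .
  moreover have "?p e e x = x" if "x \<in> Z" for x
  proof (rule power_sys_ext)
    show "x \<in> ?P e" using that sZ by blast
    then show "?p e e x l = x l" if "l < d" for l
      using that power_sysD[of x d "W e" l] pid[OF eF] by (simp add: cmap_def)
    show "?p e e x \<in> ?P e" using that sZ sys_homD(4)[OF ht[of e e]] ze[OF eF] by blast
  qed
  then have "V e = Z" unfolding V_def by simp
  ultimately show ?thesis by simp
qed

theorem theoremC:
  fixes X :: "'a::metric_space set" and T :: "'a \<Rightarrow> 'a" and d :: nat
    and Z :: "(nat \<Rightarrow> 'a) set"
  assumes PI: "minimal_PI TYPE('w::metric_space) TYPE('i) X T"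
    and d: "d \<ge> 2"
    and sub: "subsystem Z (power_sys d X) (tau d T)"
    and M: "M_system Z (tau d T)"
  shows "minimal_sys Z (tau d T)"
proof -
  obtain r :: "'i rel" and z e and W :: "'i \<Rightarrow> 'w set" and S p and \<phi> :: "'w \<Rightarrow> 'a" where
    tower: "strictly_PI_tower r z e W S p" and fac: "factor_map (W e) (S e) X T \<phi>"
    and prox: "proximal_ext (W e) (S e) \<phi>" and X: "tds X T"
    using PI unfolding minimal_PI_def by blast
  have "tds (W e) (S e)" using tower unfolding strictly_PI_tower_def by blast
  then have h: "sys_hom (W e) (S e) X T \<phi>" using X fac by (rule factor_map_imp_sys_hom)
  have "M_sub Z (power_sys d X) (tau d T)"
    using sub M by (rule M_system_imp_M_sub[OF compact_sys_tau[OF tds_imp_compact_sys[OF X]]])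
  moreover have "\<phi> ` W e = X" using fac by (simp add: factor_map_def)
  ultimately obtain Z' where Z': "M_sub Z' (power_sys d (W e)) (tau d (S e))"
    "cmap d (\<lambda>_. \<phi>) ` Z' = Z"
    using M_sub_lift[OF sys_hom_tau[OF h] cmap_image_power_sys proximal_ext_imp_minimal_faithful[OF h prox]]
    by blast
  \<comment> \<open>The tower makes the lift minimal, and minimality descends to its image
    \<open>Z\<close>.\<close>
  have "minimal_sub (cmap d (\<lambda>_. \<phi>) ` Z') (power_sys d X) (tau d T)"
    by (rule minimal_sub_image[OF sys_hom_tau[OF h] strictly_PI_tower_minimal[OF tower Z'(1)]])
  then show ?thesis unfolding Z'(2) minimal_sub_def by simp
qed

end
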